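(* Let $A \subset \mathbb{Z}^d$ be a finite set with $0 \in \operatorname{ex}(H(A))$ and $\Lambda_A = \mathbb{Z}^d$. Then \[ N_{\operatorname{Str}}(A) \leqslant (d+1)\kappa(A) \Big(d!\operatorname{Vol}(H(A)) + \big(\lvert\operatorname{ex}(H(A))\rvert - d - 1\big) \operatorname{Vol}^{\dagger,\max}(H(A))\Big) \] and \[ N_{\operatorname{Str}}(A) \leqslant (d+1)\kappa(A) \big(\vert A\vert - d - 1\big) \operatorname{Vol}^{\dagger,\max}(H(A)). \]
   Context: $H(A)$ is the convex hull of $A$, $\operatorname{ex}(H(A))\subset A$ its set of extreme points (vertices), $\operatorname{Vol}$ is Lebesgue volume, and $\Lambda_A$ is the lattice generated by $A$. For a positive integer $N$, $NA=\{a_1+\cdots+a_N: a_i\in A\}$. For a finite $X\subset\mathbb{Z}^d$ with $0\in X$, let $C_X=\{\sum_{x\in X}c_x x: c_x\geqslant 0\}$ be the cone generated by $X$, $\mathcal{P}(X)=\bigcup_{N\geqslant 1}NX$, and $\mathcal{E}(X)=(C_X\cap\mathbb{Z}^d)\setminus\mathcal{P}(X)$ (the exceptional set). $N_{\operatorname{Str}}(A)$ is the least positive integer $N_0$ such that for all $N\geqslant N_0$, \[ NA = (NH(A) \cap \mathbb{Z}^d) \setminus \Big( \bigcup_{a \in \operatorname{ex}(H(A))} (aN - \mathcal{E}(a-A))\Big). \] Writing $A=\{a_1,\dots,a_\ell\}$, $\operatorname{Vol}^{\dagger,\max}(H(A)) := \max |\det ( a_{i_1}-a_{i_0} , \dots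 , a_{i_{d}}-a_{i_0})|$ over $(d+1)$-element index subsets $\{i_0,\dots,i_d\}\subset\{1,\dots,\ell\}$. For a facet ($(d-1)$-dimensional face) $F$ of $H(A)$ and $a\in A\setminus F$, let $\operatorname{Vol}(F,a)$ be the volume of the convex hull of $F\cup\{a\}$; then $\kappa(A)=\max_F \frac{\max_{a\in A\setminus F}\operatorname{Vol}(F,a)}{\min_{a\in A\setminus F}\operatorname{Vol}(F,a)}$, the outer maximum over all facets $F$ of $H(A)$.
   Formalization: The second bound is stated only for |A| ≠ d+1: when |A| = d+1 its right side is 0 while N_Str(A) is a positive integer (e.g. d=1, A={0,1}), so it is false; in that case N_Str(A) = 1 is proved instead. The dimension d is at least 1. *)

theory Defs
  imports "HOL-Analysis.Analysis"
begin

definition int_lattice :: "(real^'n) set" where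
  "int_lattice = {x. \<forall>i. x $ i \<in> \<int>}"

definition gen_lattice :: "(real^'n) set \<Rightarrow> (real^'n) set" where
  "gen_lattice A = {\<Sum>a\<in>A. of_int (c a) *\<^sub>R a | c :: real^'n \<Rightarrow> int. True}"

definition nfold_sum :: "nat \<Rightarrow> (real^'n) set \<Rightarrow> (real^'n) set" where
  "nfold_sum N A = {\<Sum>i<N. a i | a. \<forall>i<N. a i \<in> A}"

text \<open>For the convex set \<open>H(A)\<close> the \<open>N\<close>-fold sumset and the dilate by \<open>N\<close> coincide, so
  the notation \<open>N H(A)\<close> is unambiguous.\<close>

lemma nfold_sum_convex:
  assumes "convex S" and "N > 0"
  shows "nfold_sum N S = (*\<^sub>R) (real N) ` S"
proof
  show "nfold_sum N S \<subseteq> (*\<^sub>R) (real N) ` S"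
  proof
    fix x assume "x \<in> nfold_sum N S"
    then obtain a where x: "x = (\<Sum>i<N. a i)" and a: "\<forall>i<N. a i \<in> S"
      by (auto simp: nfold_sum_def)
    have "(\<Sum>i<N. (1 / real N) *\<^sub>R a i) \<in> S"
      using assms a by (intro convex_sum) auto
    then have "(1 / real N) *\<^sub>R x \<in> S"
      by (simp add: x scaleR_sum_right)
    then show "x \<in> (*\<^sub>R) (real N) ` S"
      using assms(2) by (intro image_eqI[where x = "(1 / real N) *\<^sub>R x"]) auto
  qed
  show "(*\<^sub>R) (real N) ` S \<subseteq> nfold_sum N S"
  proof
    fix x assume "x \<in> (*\<^sub>R) (real N) ` S"
    then obtain s where "s \<in> S" "x = real N *\<^sub>R s" by auto
    then show "x \<in> nfold_sum N S"
      unfolding nfold_sum_def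
      by (auto simp: sum_constant_scaleR simp del: sum_constant intro!: exI[where x = "\<lambda>_. s"])
  qed
qed

definition gen_cone :: "(real^'n) set \<Rightarrow> (real^'n) set" where
  "gen_cone X = {\<Sum>x\<in>X. c x *\<^sub>R x | c :: real^'n \<Rightarrow> real. \<forall>x\<in>X. c x \<ge> 0}"

definition all_sums :: "(real^'n) set \<Rightarrow> (real^'n) set" where
  "all_sums X = (\<Union>N\<in>{1..}. nfold_sum N X)"

definition exceptional :: "(real^'n) set \<Rightarrow> (real^'n) set" where
  "exceptional X = (gen_cone X \<inter> int_lattice) - all_sums X"

definition hull_vertices :: "(real^'n) set \<Rightarrow> (real^'n) set" where
  "hull_vertices A = {v. v extreme_point_of (convex hull A)}"

definition structure_holds :: "(real^'n) set \<Rightarrow> nat \<Rightarrow> bool" where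
  "structure_holds A N \<longleftrightarrow>
     nfold_sum N A = (nfold_sum N (convex hull A) \<inter> int_lattice) -
       (\<Union>a\<in>hull_vertices A. (\<lambda>e. real N *\<^sub>R a - e) ` exceptional ((\<lambda>b. a - b) ` A))"

definition structure_from :: "(real^'n) set \<Rightarrow> nat \<Rightarrow> bool" where
  "structure_from A N0 \<longleftrightarrow> N0 > 0 \<and> (\<forall>N\<ge>N0. structure_holds A N)"

definition N_Str :: "(real^'n) set \<Rightarrow> nat" where
  "N_Str A = (LEAST N0. structure_from A N0)"

text \<open>A choice of \<open>d + 1\<close> distinct points of \<open>A\<close> is a base point \<open>b\<close> together with an injective
  family \<open>v\<close>, indexed by the coordinate type, that avoids \<open>b\<close>; the columns of the matrix are the
  differences \<open>v j - b\<close>. The order of the points does not affect the absolute value.\<close>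

definition vol_dagger_max :: "(real^'n) set \<Rightarrow> real" where
  "vol_dagger_max A =
     Max {\<bar>det (\<chi> i j. (v j - b) $ i :: real^'n^'n)\<bar> | b (v :: 'n \<Rightarrow> real^'n).
            b \<in> A \<and> range v \<subseteq> A \<and> inj v \<and> b \<notin> range v}"

definition vol_pyramid :: "(real^'n) set \<Rightarrow> real^'n \<Rightarrow> real" where
  "vol_pyramid F a = measure lebesgue (convex hull (insert a F))"

definition kappa :: "(real^'n) set \<Rightarrow> real" where
  "kappa A =
     Max {Max (vol_pyramid F ` (A - F)) / Min (vol_pyramid F ` (A - F)) | F.
            F facet_of (convex hull A)}"

text \<open>The second bound fails when \<open>A\<close> has exactly \<open>d + 1\<close> elements: its right-hand side is then
  \<open>0\<close>, whereas \<open>N_Str\<close> is by definition a positive integer. In that case \<open>A\<close> consists of \<open>0\<close> and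
  a basis of the integer lattice, the exceptional sets are empty, and the threshold equals \<open>1\<close>.
  The main theorem therefore separates this case from \<open>card A > d + 1\<close>; no smaller
  cardinality occurs, since \<open>0 \<in> A\<close> and \<open>A\<close> generates the integer lattice.\<close>

end

theory Submission imports Defs begin

text \<open>
  Let \<open>x\<close> lie in the right-hand side.  By Caratheodory some vertex \<open>v0\<close> has coefficient at least
  \<open>N / (d + 1)\<close> in a real representation of \<open>x\<close>, and \<open>x \<notin> N v0 - \<E>(v0 - A)\<close> gives an integral one with
  coefficient sum \<open>N\<close> in which only the coefficient of \<open>v0\<close> may be negative; it has to be made
  nonnegative.  First, non-vertices are traded for vertices: pull a triangulation of \<open>H(A)\<close> and apply
  the pigeonhole principle to partial sums modulo the lattice of each simplex, whose index is its
  normalized volume; at most \<open>d! Vol(H(A))\<close> non-vertices survive.  (For the second bound this step is skipped, and \<open>V = A\<close> replaces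
  \<open>V = ex(H(A))\<close> in the following one.)  Secondly, the difference between
  the part of the integral representation on \<open>V\<close> and a real one on a facet pyramid with apex \<open>v0\<close> is an affine
  dependence, hence a conformal combination of at most \<open>card V - d - 1\<close> integral circuits, whose
  entries are determinants.  A circuit with multiplicity at least \<open>1\<close> can be subtracted, so at a
  minimum the two coefficients of \<open>v0\<close> are close.  The factor \<open>\<kappa>\<close> enters through the weights of the
  surviving non-vertices with respect to the facet.
\<close>

subsection \<open>Volumes under linear maps\<close>

text \<open>The obstacle: \<open>v0\<close> is chosen from one real representation of
  \<open>x\<close>, while the facet pyramid comes from the part on \<open>V\<close> of the integral
  one, so \<open>N / (d + 1)\<close> says nothing directly about the apex coefficient there. The
  link is the height \<open>\<beta> - n \<bullet> a\<close> relative to the facet. The total height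
  depends only on \<open>x\<close> and \<open>N\<close>. By the choice of \<open>v0\<close> it is at
  least \<open>N / (d + 1)\<close> times the height of \<open>v0\<close>; in the second
  representation only the apex and the points outside \<open>V\<close>, of total multiplicity at
  most \<open>R\<close>, contribute, the latter at most \<open>kappa A\<close> heights of
  \<open>v0\<close> each, because heights are proportional to pyramid volumes. So the real apex
  coefficient is at least \<open>N / (d + 1) - kappa A * R\<close>, and the passage to an integral
  one loses at most \<open>vol_dagger_max A\<close> per circuit. A vertex is needed as apex: only
  then is the mean of the other points different from \<open>v0\<close>, so that the ray through it
  leaves by a facet missing \<open>v0\<close>. An integer above -1 is nonnegative; this is the
  origin of the -1 in the thresholds, and it lets the floor of a bound serve as
  \<open>N0\<close>.\<close>

text \<open>The library proves this for well-ordered index types only.\<close>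

proposition
  fixes f :: "real^'n \<Rightarrow> real^'n"
  assumes "linear f" "S \<in> lmeasurable"
  shows lmeasurable_linear_image_cart: "f ` S \<in> lmeasurable"
    and measure_linear_image_cart:
      "measure lebesgue (f ` S) = \<bar>det (matrix f)\<bar> * measure lebesgue S"
proof -
  define P where "P f \<longleftrightarrow> (\<forall>S \<in> lmeasurable. f ` S \<in> lmeasurable \<and>
      measure lebesgue (f ` S) = \<bar>det (matrix f)\<bar> * measure lebesgue S)" for f :: "real^'n \<Rightarrow> real^'n"
  \<comment> \<open>For maps of determinant 1 or -1 it suffices to test boxes with a corner at 0:
    translations reach all boxes, and \<open>measure_linear_sufficient\<close> with factor 1 does
    the rest.\<close>
  have box: "P h" if lin: "linear h" and det: "\<bar>det (matrix h)\<bar> = 1"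
    and cube: "\<And>c. cbox 0 c \<noteq> {} \<Longrightarrow> measure lebesgue (h ` cbox 0 c) = measure lebesgue (cbox 0 c)"
    for h :: "real^'n \<Rightarrow> real^'n"
  proof -
    have "measure lebesgue (h ` cbox a b) = measure lebesgue (cbox a b)" for a b
    proof (cases "cbox a b = {}")
      case False
      have ab: "cbox a b = (+) a ` cbox 0 (b - a)"
        by (metis cbox_translation add.right_neutral add_diff_cancel_left' diff_add_cancel add.commute)
      then have "cbox 0 (b - a) \<noteq> {}"
        using False by (metis image_empty)
      have "h ` (+) a ` S = (+) (h a) ` h ` S" for S
        by (simp add: image_image linear_add[OF lin])
      then have "measure lebesgue (h ` cbox a b) = measure lebesgue (h ` cbox 0 (b - a))"
        by (metis ab measure_translation)
      also have "\<dots> = measure lebesgue (cbox 0 (b - a))"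
        by (rule cube) fact
      also have "\<dots> = measure lebesgue (cbox a b)"
        by (metis ab measure_translation)
      finally show ?thesis .
    qed simp
    then have "h ` S \<in> lmeasurable \<and> 1 * measure lebesgue S = measure lebesgue (h ` S)"
      if "S \<in> lmeasurable" for S
      by (intro measure_linear_sufficient[OF lin that]) (simp only: mult_1)
    then show ?thesis
      unfolding P_def det by metis
  qed
  have "P f"
  proof (rule induct_linear_elementary[OF assms(1)])
    fix f g :: "real^'n \<Rightarrow> real^'n"
    assume "linear f" "linear g" and P: "P f" "P g"
    then have "\<bar>det (matrix (f \<circ> g))\<bar> = \<bar>det (matrix f)\<bar> * \<bar>det (matrix g)\<bar>"
      by (simp add: matrix_compose det_mul abs_mult)
    then show "P (f \<circ> g)"
      using P unfolding P_def image_comp[symmetric] by simp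
  next
    fix f :: "real^'n \<Rightarrow> real^'n" and i
    assume f: "linear f" and "\<And>x. f x $ i = 0"
    then have "axis i 1 \<notin> range f"
      by (metis axis_nth one_neq_zero rangeE)
    then have "\<not> inj f"
      using linear_injective_imp_surjective[OF f] by auto
    then have "negligible (f ` S)" for S
      using f negligible_linear_singular_image by blast
    moreover have "det (matrix f) = 0"
      using \<open>\<not> inj f\<close> det_nz_iff_inj[OF f] by blast
    ultimately show "P f"
      by (simp add: P_def negligible_iff_measure)
  next
    fix c :: "'n \<Rightarrow> real"
    have "det (matrix (\<lambda>x. \<chi> i. c i * x $ i)) = prod c UNIV"
      by (subst det_diagonal) (auto simp: matrix_def axis_def)
    then show "P (\<lambda>x. \<chi> i. c i * x $ i)"
      by (simp add: P_def measurable_stretch measure_stretch)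
  next
    fix m n :: 'n
    assume "m \<noteq> n"
    define h :: "real^'n \<Rightarrow> real^'n" where "h = (\<lambda>x. \<chi> i. x $ Transposition.transpose m n i)"
    have lin: "linear h"
      by (rule linearI) (simp_all add: h_def vec_eq_iff)
    have inv: "h (h x) = x" for x
      by (simp add: h_def vec_eq_iff)
    then have "h \<circ> h = id" by auto
    then have "det (matrix h) * det (matrix h) = 1"
      using matrix_compose[OF lin lin] by (metis det_I det_mul matrix_id_mat_1)
    then have det: "\<bar>det (matrix h)\<bar> = 1"
      using abs_square_eq_1[of "det (matrix h)"] by (simp add: power2_eq_square)
    have img: "h ` cbox 0 c = cbox 0 (h c)" for c
    proof -
      have sub: "h ` cbox 0 c \<subseteq> cbox 0 (h c)" for c
        by (auto simp: h_def mem_box_cart)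
      have "h ` h ` cbox 0 (h c) \<subseteq> h ` cbox 0 c"
        using image_mono[OF sub[of "h c"]] by (simp add: inv)
      then show ?thesis
        using sub[of c] by (simp add: image_image inv subset_antisym)
    qed
    have "measure lebesgue (h ` cbox 0 c) = measure lebesgue (cbox 0 c)" if "cbox 0 c \<noteq> {}" for c
    proof -
      have ne: "cbox 0 (h c) \<noteq> {}"
        using that img by (metis image_is_empty)
      have "(\<Prod>i\<in>UNIV. h c $ i) = (\<Prod>i\<in>UNIV. c $ i)"
        using prod.permute[OF permutes_swap_id, of m UNIV n "\<lambda>i. c $ i"]
        by (simp add: h_def o_def)
      then show ?thesis
        using that ne by (simp add: img content_cbox_cart)
    qed
    then have "P h"
      by (rule box[OF lin det])
    then show "P (\<lambda>x. \<chi> i. x $ Transposition.transpose m n i)"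
      by (simp only: h_def)
  next
    fix m n :: 'n
    assume mn: "m \<noteq> n"
    define h :: "real^'n \<Rightarrow> real^'n" where "h = (\<lambda>x. \<chi> i. if i = m then x $ m + x $ n else x $ i)"
    have lin: "linear h"
      by (rule linearI) (simp_all add: h_def vec_eq_iff algebra_simps)
    have "matrix h = (\<chi> k. if k = m then row m (mat 1) + 1 *s row n (mat 1) else row k (mat 1))"
      by (auto simp: matrix_def h_def vec_eq_iff row_def mat_def axis_def)
    then have "det (matrix h) = 1"
      by (simp only: det_row_operation[OF mn] det_I)
    then have det: "\<bar>det (matrix h)\<bar> = 1"
      by simp
    have "measure lebesgue (h ` cbox 0 c) = measure lebesgue (cbox 0 c)" if "cbox 0 c \<noteq> {}" for c
      unfolding h_def by (rule measure_shear_interval[OF mn that]) simp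
    then have "P h"
      by (rule box[OF lin det])
    then show "P (\<lambda>x. \<chi> i. if i = m then x $ m + x $ n else x $ i)"
      by (simp only: h_def)
  qed
  with assms(2) show "f ` S \<in> lmeasurable"
    "measure lebesgue (f ` S) = \<bar>det (matrix f)\<bar> * measure lebesgue S"
    by (auto simp: P_def)
qed

text \<open>Conjugating by the identity matrix with row \<open>k\<close> replaced by \<open>n\<close>, where \<open>n $ k \<noteq> 0\<close>,
  turns the functional \<open>n\<close> into a coordinate; Cramer's lemma then applies.\<close>

lemma det_rank_one_update:
  fixes n u :: "real^'n"
  shows "det (matrix (\<lambda>x. x - (n \<bullet> x) *\<^sub>R u)) = 1 - n \<bullet> u"
proof (cases "n = 0")
  case True
  then show ?thesis by (simp flip: id_def)
next
  case False
  then obtain k where k: "n $ k \<noteq> 0"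
    by (metis vec_eq_iff zero_index)
  define P :: "real^'n^'n" where "P = (\<chi> i. if i = k then n else axis i 1)"
  define L where "L = matrix (\<lambda>x. x - (n \<bullet> x) *\<^sub>R u)"
  \<comment> \<open>This is \<open>P L P^-1\<close>: the functional has become coordinate
    \<open>k\<close>, so only column \<open>k\<close> differs from the identity. The factor
    \<open>mat 1\<close> gives the shape that \<open>cramer_lemma\<close> expects.\<close>
  define L' :: "real^'n^'n" where
    "L' = (\<chi> i j. if j = k then (mat 1 *v (axis k 1 - P *v u)) $ i else mat 1 $ i $ j)"
  have linL: "linear (\<lambda>x. x - (n \<bullet> x) *\<^sub>R u)"
    by (rule linearI) (simp_all add: algebra_simps inner_add_right)
  have Pn: "(P *v x) $ i = (if i = k then n \<bullet> x else x $ i)" for x i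
    by (simp add: P_def matrix_vector_mul_component inner_axis')
  have L'x: "(L' *v x) $ i = x $ i - x $ k * (P *v u) $ i" for x i
  proof -
    have "(L' *v x) $ i = (\<Sum>j\<in>UNIV. (if j = k then (axis k 1 - P *v u) $ i else mat 1 $ i $ j) * x $ j)"
      unfolding L'_def matrix_vector_mul_lid by (simp add: matrix_vector_mult_def)
    also have "\<dots> = (\<Sum>j\<in>UNIV. (if j = i then x $ i else 0) - (if j = k then x $ k * (P *v u) $ i else 0))"
      by (intro sum.cong) (auto simp: mat_def axis_def algebra_simps)
    finally show ?thesis by (simp add: sum_subtractf)
  qed
  have "P *v (L *v x) = L' *v (P *v x)" for x
  proof -
    have L: "L *v x = x - (n \<bullet> x) *\<^sub>R u"
      unfolding L_def by (simp add: matrix_vector_mul(2)[OF linL, THEN fun_cong])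
    show ?thesis
      unfolding L vec_eq_iff by (auto simp: L'x Pn algebra_simps inner_diff_right)
  qed
  then have "P ** L = L' ** P"
    by (simp add: matrix_eq matrix_vector_mul_assoc)
  then have "det P * det L = det L' * det P"
    by (metis det_mul)
  moreover have "det L' = (axis k 1 - P *v u) $ k * det (mat 1 :: real^'n^'n)"
    unfolding L'_def by (rule cramer_lemma)
  moreover have "det P = n $ k * det (mat 1 :: real^'n^'n)"
  proof -
    have "(\<Sum>i\<in>UNIV. n $ i *s row i (mat 1)) = n"
      by (simp add: vec_eq_iff row_def mat_def if_distrib cong: if_cong)
    moreover have "row i (mat 1 :: real^'n^'n) = axis i 1" for i
      by (simp add: vec_eq_iff row_def mat_def axis_def)
    ultimately show ?thesis
      using cramer_lemma_transpose[of k n "mat 1 :: real^'n^'n"] by (simp only: P_def)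
  qed
  ultimately have "det L = 1 - n \<bullet> u"
    using k by (simp add: Pn)
  then show ?thesis by (simp add: L_def)
qed

text \<open>The affine map that fixes the hyperplane \<open>n \<bullet> x = \<beta>\<close> pointwise and moves \<open>v\<close> to \<open>a\<close> sends
  one pyramid to the other.\<close>

lemma vol_pyramid_ratio:
  fixes F :: "(real^'n) set"
  assumes F: "F \<subseteq> {x. n \<bullet> x = \<beta>}" "bounded F" and v: "n \<bullet> v < \<beta>" and a: "n \<bullet> a \<le> \<beta>"
  shows "vol_pyramid F a = (\<beta> - n \<bullet> a) / (\<beta> - n \<bullet> v) * vol_pyramid F v"
proof -
  define n' where "n' = (1 / (\<beta> - n \<bullet> v)) *\<^sub>R n"
  define f where "f = (\<lambda>x. x - (n' \<bullet> x) *\<^sub>R (a - v))"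
  define c where "c = (\<beta> / (\<beta> - n \<bullet> v)) *\<^sub>R (a - v)"
  have lin: "linear f"
    unfolding f_def by (rule linearI) (simp_all add: algebra_simps inner_add_right)
  have fx: "c + f x = x + ((\<beta> - n \<bullet> x) / (\<beta> - n \<bullet> v)) *\<^sub>R (a - v)" for x
    by (simp add: f_def c_def n'_def diff_divide_distrib scaleR_diff_left)
  have "(\<lambda>x. c + f x) ` insert v F = insert a F"
    using F(1) v by (force simp: fx)
  then have "insert a F = (+) c ` f ` insert v F"
    by (simp only: image_image)
  then have img: "convex hull (insert a F) = (+) c ` f ` (convex hull (insert v F))"
    by (simp only: convex_hull_linear_image[OF lin] convex_hull_translation)
  have "bounded (convex hull (insert v F))"
    using F(2) by (simp add: bounded_convex_hull)
  then have meas: "convex hull (insert v F) \<in> lmeasurable"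
    by (simp add: measurable_convex)
  have det: "det (matrix f) = (\<beta> - n \<bullet> a) / (\<beta> - n \<bullet> v)"
  proof -
    have "n \<bullet> (a - v) = (\<beta> - n \<bullet> v) - (\<beta> - n \<bullet> a)"
      by (simp add: inner_diff_right)
    then have "n' \<bullet> (a - v) = ((\<beta> - n \<bullet> v) - (\<beta> - n \<bullet> a)) / (\<beta> - n \<bullet> v)"
      by (simp add: n'_def)
    also have "\<dots> = 1 - (\<beta> - n \<bullet> a) / (\<beta> - n \<bullet> v)"
      by (subst diff_divide_distrib) (use v in simp)
    finally show ?thesis
      unfolding f_def det_rank_one_update by simp
  qed
  show ?thesis
    unfolding vol_pyramid_def img measure_translation measure_linear_image_cart[OF lin meas] det
    using v a by simp
qed

section \<open>Normalized volumes of simplices\<close>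

text \<open>The hull is the image of the standard simplex, of volume 1/d!, under
  \<open>x \<mapsto> b + M *v x\<close>. Degenerate families are included, so
  \<open>nvol_replace\<close> need not check that its new point set is independent.\<close>

lemma measure_simplex_cart:
  fixes v :: "'n \<Rightarrow> real^'n"
  shows "measure lebesgue (convex hull (insert b (range v))) =
    \<bar>det (\<chi> i j. (v j - b) $ i)\<bar> / fact CARD('n)"
proof -
  define M :: "real^'n^'n" where "M = (\<chi> i j. (v j - b) $ i)"
  define std :: "(real^'n) set" where "std = convex hull (insert 0 Basis)"
  have Mj: "M *v axis j 1 = v j - b" for j
    by (simp add: M_def matrix_vector_mult_basis column_def vec_eq_iff)
  have "(\<lambda>x. b + M *v x) ` insert 0 Basis = insert b (range v)"
    by (auto simp: Basis_vec_def Mj image_iff)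
  then have "insert b (range v) = (+) b ` (*v) M ` insert 0 Basis"
    by (simp only: image_image)
  then have img: "convex hull (insert b (range v)) = (+) b ` (*v) M ` std"
    by (simp only: std_def convex_hull_linear_image[OF matrix_vector_mul_linear] convex_hull_translation)
  have "compact std"
    by (simp add: std_def finite_imp_compact_convex_hull)
  then have meas: "std \<in> lmeasurable"
    by (simp add: lmeasurable_compact)
  have "measure lebesgue std = 1 / fact CARD('n)"
    using content_std_simplex[where 'a = "real^'n"] \<open>compact std\<close>
    by (simp add: std_def measure_completion compact_imp_closed borel_closed)
  then show ?thesis
    unfolding img measure_translation
      measure_linear_image_cart[OF matrix_vector_mul_linear meas] matrix_of_matrix_vector_mul
    by (simp add: M_def)
qed

text \<open>The factor d! turns the volume of a simplex into the absolute determinant of its edge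
  vectors, an integer for lattice simplices. Defining it by volume makes it independent of the base
  point and the order of the points.\<close>

definition nvol :: "(real^'n) set \<Rightarrow> real" where
  "nvol S = fact CARD('n) * measure lebesgue (convex hull S)"

lemma nvol_simplex:
  fixes v :: "'n \<Rightarrow> real^'n"
  shows "nvol (insert b (range v)) = \<bar>det (\<chi> i j. (v j - b) $ i)\<bar>"
  by (simp add: nvol_def measure_simplex_cart)

lemma nvol_nonneg: "0 \<le> nvol S"
  by (simp add: nvol_def)

text \<open>Matrix columns are indexed by the coordinate type, so the \<open>d\<close> points other
  than the base point must be enumerated by it.\<close>

lemma simplex_enum:
  fixes J :: "(real^'n) set"
  assumes "card J = CARD('n) + 1" "b \<in> J"
  obtains v :: "'n \<Rightarrow> real^'n" where "inj v" "range v = J - {b}" "J = insert b (range v)"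
proof -
  have "finite J"
    using assms(1) card.infinite by fastforce
  moreover have "card (J - {b}) = CARD('n)"
    using assms by simp
  ultimately obtain v :: "'n \<Rightarrow> real^'n" where v: "bij_betw v UNIV (J - {b})"
    using finite_same_card_bij[of "UNIV :: 'n set" "J - {b}"] by auto
  show thesis
  proof (rule that)
    show "inj v" "range v = J - {b}"
      using v by (auto simp: bij_betw_def)
    then show "J = insert b (range v)"
      using assms(2) by blast
  qed
qed

lemma finite_dets:
  fixes A :: "(real^'n) set"
  assumes "finite A"
  shows "finite {\<bar>det (\<chi> i j. (v j - b) $ i :: real^'n^'n)\<bar> | b (v :: 'n \<Rightarrow> real^'n).
            b \<in> A \<and> range v \<subseteq> A \<and> inj v \<and> b \<notin> range v}"
proof (rule finite_subset)
  show "finite ((\<lambda>(b, v). \<bar>det (\<chi> i j. (v j - b) $ i :: real^'n^'n)\<bar>) ` (A \<times> (UNIV \<rightarrow>\<^sub>E A)))"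
    using assms by (intro finite_imageI finite_cartesian_product finite_PiE) auto
qed force

lemma nvol_le_vol_dagger_max:
  fixes A :: "(real^'n) set"
  assumes "finite A" "J \<subseteq> A" "card J = CARD('n) + 1"
  shows "nvol J \<le> vol_dagger_max A"
proof -
  obtain b where b: "b \<in> J"
    using assms(3) by fastforce
  obtain v :: "'n \<Rightarrow> real^'n" where v: "inj v" "range v = J - {b}" "J = insert b (range v)"
    using simplex_enum[OF assms(3) b] .
  have "b \<notin> range v"
    using v(2) by blast
  moreover have "nvol J = \<bar>det (\<chi> i j. (v j - b) $ i)\<bar>"
    by (subst v(3)) (rule nvol_simplex)
  moreover have "b \<in> A" "range v \<subseteq> A"
    using v(2) b assms(2) by blast+
  ultimately show ?thesis
    unfolding vol_dagger_max_def using v(1) by (intro Max_ge finite_dets assms(1)) blast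
qed

lemma det_Ints:
  fixes M :: "real^'n^'n"
  assumes "\<And>i j. M $ i $ j \<in> \<int>"
  shows "det M \<in> \<int>"
  unfolding det_def using assms by (intro Ints_sum Ints_mult Ints_prod) auto

lemma nvol_Ints:
  fixes J :: "(real^'n) set"
  assumes "J \<subseteq> int_lattice" "card J = CARD('n) + 1"
  shows "nvol J \<in> \<int>"
proof -
  obtain b where b: "b \<in> J"
    using assms(2) by fastforce
  obtain v :: "'n \<Rightarrow> real^'n" where v: "J = insert b (range v)"
    using simplex_enum[OF assms(2) b] .
  then have "b \<in> int_lattice" "v j \<in> int_lattice" for j
    using assms(1) by auto
  then have "det (\<chi> i j. (v j - b) $ i) \<in> \<int>"
    by (intro det_Ints) (auto simp: int_lattice_def)
  then show ?thesis
    by (subst v) (simp add: nvol_simplex)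
qed

lemma measure_convex_hull_pos:
  fixes S :: "(real^'n) set"
  assumes "bounded S" "affine hull S = UNIV"
  shows "0 < measure lebesgue (convex hull S)"
proof -
  have "affine hull (convex hull S) = UNIV"
    using assms(2) by simp
  moreover from this have "convex hull S \<noteq> {}"
    by force
  ultimately have "interior (convex hull S) \<noteq> {}"
    using rel_interior_interior[of "convex hull S"] rel_interior_eq_empty[of "convex hull S"] by simp
  then have "\<not> negligible (convex hull S)"
    by (simp add: negligible_convex_interior)
  moreover have "convex hull S \<in> lmeasurable"
    using assms(1) by (simp add: measurable_convex bounded_convex_hull)
  ultimately show ?thesis
    by (simp add: negligible_iff_measure zero_less_measure_iff)
qed

lemma card_simplex:
  fixes J :: "(real^'n) set"
  assumes "\<not> affine_dependent J" "affine hull J = UNIV"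
  shows "finite J" "card J = CARD('n) + 1"
proof -
  have "aff_dim J = int CARD('n)"
    using assms(2) aff_dim_eq_full[of J] by simp
  then show "finite J" "card J = CARD('n) + 1"
    using assms(1) affine_independent_iff_card[of J] by auto
qed

lemma nvol_pos:
  fixes J :: "(real^'n) set"
  assumes "\<not> affine_dependent J" "affine hull J = UNIV"
  shows "0 < nvol J"
  using measure_convex_hull_pos[of J] assms aff_independent_finite[of J]
  by (simp add: nvol_def finite_imp_bounded)

text \<open>Cramer's rule in barycentric coordinates; the base point of the determinant is chosen
  different from \<open>i\<close>.\<close>

lemma nvol_replace:
  fixes J :: "(real^'n) set"
  assumes J: "card J = CARD('n) + 1" and i: "i \<in> J"
    and \<beta>: "sum \<beta> J = 1" "(\<Sum>j\<in>J. \<beta> j *\<^sub>R j) = p"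
  shows "nvol (insert p (J - {i})) = \<bar>\<beta> i\<bar> * nvol J"
proof -
  have "finite J"
    using J card.infinite by fastforce
  have "J \<noteq> {i}"
    using J by auto
  then obtain b where b: "b \<in> J" "b \<noteq> i"
    using i by blast
  obtain v :: "'n \<Rightarrow> real^'n" where v: "inj v" "range v = J - {b}" "J = insert b (range v)"
    using simplex_enum[OF J b(1)] .
  obtain k where k: "v k = i"
    using v(3) b i by blast
  define M :: "real^'n^'n" where "M = (\<chi> i j. (v j - b) $ i)"
  have "p - b = (\<Sum>j\<in>J. \<beta> j *\<^sub>R (j - b))"
    using \<beta> by (simp add: scaleR_diff_right sum_subtractf flip: scaleR_sum_left)
  also have "\<dots> = (\<Sum>j\<in>J - {b}. \<beta> j *\<^sub>R (j - b))"
    using \<open>finite J\<close> by (intro sum.mono_neutral_right) auto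
  also have "\<dots> = (\<Sum>j\<in>UNIV. \<beta> (v j) *\<^sub>R (v j - b))"
    unfolding v(2)[symmetric] by (simp add: sum.reindex[OF v(1)])
  also have "\<dots> = M *v (\<chi> j. \<beta> (v j))"
    by (simp add: M_def matrix_vector_mult_def vec_eq_iff mult.commute)
  finally have pb: "p - b = M *v (\<chi> j. \<beta> (v j))" .
  have "range (v(k := p)) = insert p (v ` (UNIV - {k}))"
    by (simp add: fun_upd_image Compl_eq_Diff_UNIV[symmetric] Compl_eq set_diff_eq)
  also have "v ` (UNIV - {k}) = J - {b} - {i}"
    using image_set_diff[OF v(1), of UNIV "{k}"] by (simp add: v(2) k)
  finally have "insert p (J - {i}) = insert b (range (v(k := p)))"
    using b by blast
  moreover have "(\<chi> i j. ((v(k := p)) j - b) $ i) =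
      (\<chi> i j. if j = k then (M *v (\<chi> j. \<beta> (v j))) $ i else M $ i $ j)"
    unfolding pb[symmetric] by (simp add: vec_eq_iff M_def)
  ultimately have "nvol (insert p (J - {i})) = \<bar>\<beta> i * det M\<bar>"
    by (simp only: nvol_simplex cramer_lemma) (simp add: k)
  moreover have "nvol J = \<bar>det M\<bar>"
    by (subst v(3)) (simp add: nvol_simplex M_def)
  ultimately show ?thesis
    by (simp add: abs_mult)
qed

subsection \<open>Affine dependences with integral coefficients\<close>

text \<open>\<open>affine_rel V (\<lambda>v. m' v - m v)\<close> expresses that \<open>m'\<close>
  and \<open>m\<close> represent the same point with the same coefficient sum.\<close>

definition affine_rel :: "(real^'n) set \<Rightarrow> (real^'n \<Rightarrow> real) \<Rightarrow> bool" where
  "affine_rel S u \<longleftrightarrow> sum u S = 0 \<and> (\<Sum>v\<in>S. u v *\<^sub>R v) = 0"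

text \<open>Sign compatibility and inclusion of supports: subtracting a small multiple of
  \<open>u\<close> moves coordinates of \<open>z\<close> towards 0 only and creates no new nonzero
  ones.\<close>

definition conformal :: "(real^'n) set \<Rightarrow> (real^'n \<Rightarrow> real) \<Rightarrow> (real^'n \<Rightarrow> real) \<Rightarrow> bool" where
  "conformal S u z \<longleftrightarrow> affine_rel S u \<and> (\<exists>v\<in>S. u v \<noteq> 0) \<and> (\<forall>v\<in>S. 0 \<le> u v * z v \<and> (z v = 0 \<longrightarrow> u v = 0))"

lemma affine_rel_diff:
  assumes "affine_rel S u" "affine_rel S w"
  shows "affine_rel S (\<lambda>v. u v - t * w v)"
proof -
  have "(\<Sum>v\<in>S. (t * w v) *\<^sub>R v) = t *\<^sub>R (\<Sum>v\<in>S. w v *\<^sub>R v)"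
    by (simp add: scaleR_sum_right)
  moreover have "(\<Sum>v\<in>S. t * w v) = t * sum w S"
    by (simp add: sum_distrib_left)
  ultimately show ?thesis
    using assms by (simp add: affine_rel_def sum_subtractf scaleR_diff_left)
qed

lemma affine_rel_mono_neutral:
  assumes "finite T" "S \<subseteq> T" "\<And>v. v \<in> T - S \<Longrightarrow> u v = 0"
  shows "affine_rel T u \<longleftrightarrow> affine_rel S u"
proof -
  have "sum u T = sum u S" "(\<Sum>v\<in>T. u v *\<^sub>R v) = (\<Sum>v\<in>S. u v *\<^sub>R v)"
    using assms by (auto intro!: sum.mono_neutral_right)
  then show ?thesis
    by (simp add: affine_rel_def)
qed

lemma affine_rel_barycentric:
  assumes "finite S" "affine_rel S u" "p \<in> S" "u p \<noteq> 0"
  shows "(\<Sum>v\<in>S - {p}. - u v / u p) = 1" "(\<Sum>v\<in>S - {p}. (- u v / u p) *\<^sub>R v) = p"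
proof -
  have 1: "sum u (S - {p}) = - u p" and 2: "(\<Sum>v\<in>S - {p}. u v *\<^sub>R v) = - (u p *\<^sub>R p)"
    using assms(1-3) by (simp_all add: affine_rel_def sum.remove[of S p] add_eq_0_iff)
  have "(\<Sum>v\<in>S - {p}. - u v / u p) = (- 1 / u p) * sum u (S - {p})"
    by (simp add: sum_distrib_left sum_negf)
  then show "(\<Sum>v\<in>S - {p}. - u v / u p) = 1"
    using 1 assms(4) by simp
  have "(\<Sum>v\<in>S - {p}. (- u v / u p) *\<^sub>R v) = (- 1 / u p) *\<^sub>R (\<Sum>v\<in>S - {p}. u v *\<^sub>R v)"
    by (simp add: scaleR_sum_right sum_negf)
  then show "(\<Sum>v\<in>S - {p}. (- u v / u p) *\<^sub>R v) = p"
    using 2 assms(4) by simp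
qed

text \<open>Choose \<open>u\<close> with smallest support \<open>C\<close>. A dependence inside
  \<open>C - {p}\<close> could be subtracted from \<open>u\<close> until a first coordinate
  vanishes, which would give a conformal relation with smaller support.\<close>

lemma minimal_conformal:
  fixes z :: "real^'n \<Rightarrow> real"
  assumes S: "finite S" and z: "affine_rel S z" "\<exists>v\<in>S. z v \<noteq> 0"
  obtains u p where "conformal S u z" "p \<in> S" "u p \<noteq> 0"
    "\<not> affine_dependent ({v\<in>S. u v \<noteq> 0} - {p})"
proof -
  have "conformal S z z"
    using z by (simp add: conformal_def)
  then obtain u where u: "conformal S u z"
    and min: "\<And>w. conformal S w z \<Longrightarrow> card {v\<in>S. u v \<noteq> 0} \<le> card {v\<in>S. w v \<noteq> 0}"
    using ex_has_least_nat[of "\<lambda>u. conformal S u z" z "\<lambda>u. card {v\<in>S. u v \<noteq> 0}"] by blast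
  then obtain p where p: "p \<in> S" "u p \<noteq> 0"
    by (auto simp: conformal_def)
  define C where "C = {v\<in>S. u v \<noteq> 0}"
  have "\<not> affine_dependent (C - {p})"
  proof
    assume "affine_dependent (C - {p})"
    then obtain w0 where w0: "sum w0 (C - {p}) = 0" "\<exists>v\<in>C - {p}. w0 v \<noteq> 0"
      "(\<Sum>v\<in>C - {p}. w0 v *\<^sub>R v) = 0"
      using S affine_dependent_explicit_finite[of "C - {p}"] by (auto simp: C_def)
    then obtain q where q: "q \<in> C" "q \<noteq> p" "w0 q \<noteq> 0"
      by auto
    \<comment> \<open>The sign makes \<open>w\<close> and \<open>u\<close> agree in sign at
      \<open>q\<close>, so that the set \<open>P\<close> of candidates for the first vanishing
      coordinate is nonempty.\<close>
    define w where "w v = (if v \<in> C - {p} then sgn (w0 q * u q) * w0 v else 0)" for v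
    have "affine_rel (C - {p}) w"
    proof -
      have "(\<Sum>v\<in>C - {p}. w v *\<^sub>R v) = sgn (w0 q * u q) *\<^sub>R (\<Sum>v\<in>C - {p}. w0 v *\<^sub>R v)"
        by (simp add: w_def scaleR_sum_right)
      moreover have "sum w (C - {p}) = sgn (w0 q * u q) * sum w0 (C - {p})"
        by (simp add: w_def sum_distrib_left)
      ultimately show ?thesis
        using w0 by (simp add: affine_rel_def)
    qed
    then have w: "affine_rel S w"
      by (subst affine_rel_mono_neutral[OF S, of "C - {p}"]) (auto simp: C_def w_def)
    have wq: "0 < w q * u q"
      using q by (simp add: w_def C_def mult.assoc mult_sgn_abs sgn_mult)
        (metis abs_sgn mult.assoc mult.commute zero_less_abs_iff mult_pos_pos abs_mult)
    define P where "P = {v\<in>S. 0 < w v * u v}"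
    define t where "t = Min ((\<lambda>v. u v / w v) ` P)"
    have P: "finite P" "P \<noteq> {}"
      using S wq q(1) by (auto simp: P_def C_def)
    then have "t \<in> (\<lambda>v. u v / w v) ` P"
      unfolding t_def by (intro Min_in) auto
    then obtain r where r: "r \<in> P" "t = u r / w r"
      by blast
    have "0 < t"
      using r by (auto simp: P_def zero_less_mult_iff zero_less_divide_iff)
    have le: "t * \<bar>w v\<bar> \<le> \<bar>u v\<bar>" if "v \<in> P" for v
    proof -
      have "t \<le> u v / w v"
        using P(1) that by (simp add: t_def)
      moreover have "u v / w v = \<bar>u v\<bar> / \<bar>w v\<bar>" "w v \<noteq> 0"
        using that by (auto simp: P_def zero_less_mult_iff)
      ultimately show ?thesis
        by (simp add: field_simps)
    qed
    define x where "x v = u v - t * w v" for v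
    have x: "0 \<le> x v * u v \<and> (u v = 0 \<longrightarrow> x v = 0)" if "v \<in> S" for v
    proof (cases "v \<in> P")
      case True
      have "x v * u v = \<bar>u v\<bar> * (\<bar>u v\<bar> - t * \<bar>w v\<bar>)"
        using True by (auto simp: x_def P_def zero_less_mult_iff algebra_simps)
      then show ?thesis
        using le[OF True] True by (auto simp: P_def)
    next
      case False
      then have "w v * u v \<le> 0"
        using that by (simp add: P_def)
      then have "t * (w v * u v) \<le> 0"
        using \<open>0 < t\<close> by (meson mult_nonneg_nonpos less_imp_le)
      moreover have "x v * u v = (u v)\<^sup>2 - t * (w v * u v)"
        by (simp add: x_def power2_eq_square algebra_simps)
      ultimately have "0 \<le> x v * u v"
        using zero_le_power2[of "u v"] by linarith
      then show ?thesis
        using that by (auto simp: x_def w_def C_def)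
    qed
    have "conformal S x z"
      unfolding conformal_def
    proof (intro conjI ballI)
      show "affine_rel S x"
        using u w affine_rel_diff by (auto simp: conformal_def x_def[abs_def])
      \<comment> \<open>The relation \<open>w\<close> vanishes at \<open>p\<close>, so the
        coefficient there is unchanged.\<close>
      show "\<exists>v\<in>S. x v \<noteq> 0"
        using p by (intro bexI[of _ p]) (auto simp: x_def w_def)
      fix v assume v: "v \<in> S"
      have uz: "0 \<le> u v * z v" "z v = 0 \<longrightarrow> u v = 0"
        using u v by (auto simp: conformal_def)
      show "z v = 0 \<longrightarrow> x v = 0"
        using uz x[OF v] by auto
      show "0 \<le> x v * z v"
        using uz x[OF v] by (auto simp: zero_le_mult_iff)
    qed
    then have "card C \<le> card {v\<in>S. x v \<noteq> 0}"
      using min by (simp add: C_def)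
    moreover have "{v\<in>S. x v \<noteq> 0} \<subset> C"
    proof
      show "{v\<in>S. x v \<noteq> 0} \<subseteq> C"
        using x by (auto simp: C_def)
      have "r \<in> C" "x r = 0"
        using r by (auto simp: C_def P_def x_def)
      then show "{v\<in>S. x v \<noteq> 0} \<noteq> C"
        by auto
    qed
    moreover have "finite C"
      using S by (simp add: C_def)
    ultimately show False
      by (meson psubset_card_mono leD)
  qed
  then show thesis
    using that[OF u p] by (simp add: C_def)
qed


text \<open>Complete the support without \<open>p\<close> to a simplex \<open>J\<close> in
  \<open>V\<close>. Scaling the circuit so that \<open>p\<close> gets coefficient
  \<open>nvol J\<close> in absolute value makes every nonzero entry, up to sign, the normalized
  volume of a \<open>(d+1)\<close>-subset of \<open>V\<close>, by \<open>nvol_replace\<close>. Such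
  volumes are integers and at most \<open>W\<close>.\<close>

lemma integral_conformal:
  fixes V :: "(real^'n) set"
  assumes V: "finite V" "V \<subseteq> int_lattice" "affine hull V = UNIV"
    and W: "\<And>J. J \<subseteq> V \<Longrightarrow> card J = CARD('n) + 1 \<Longrightarrow> nvol J \<le> W"
    and S: "S \<subseteq> V" and z: "affine_rel S z" "\<exists>v\<in>S. z v \<noteq> 0"
  obtains e where "conformal S e z" "\<And>v. v \<in> S \<Longrightarrow> e v \<in> \<int>" "\<And>v. v \<in> S \<Longrightarrow> \<bar>e v\<bar> \<le> W"
proof -
  have "finite S"
    using S V(1) finite_subset by blast
  then obtain u p where u: "conformal S u z" and p: "p \<in> S" "u p \<noteq> 0"
    and ind: "\<not> affine_dependent ({v\<in>S. u v \<noteq> 0} - {p})"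
    using minimal_conformal z by blast
  define C where "C = {v\<in>S. u v \<noteq> 0}"
  define I where "I = C - {p}"
  have C: "finite C" "C \<subseteq> S" "p \<in> C"
    using \<open>finite S\<close> p by (auto simp: C_def)
  have "I \<subseteq> V"
    using C S by (auto simp: I_def)
  then obtain J where J: "\<not> affine_dependent J" "I \<subseteq> J" "J \<subseteq> V" "affine hull J = UNIV"
    using extend_to_affine_basis[of I V] ind V(3) by (metis C_def I_def)
  have cardJ: "finite J" "card J = CARD('n) + 1"
    using card_simplex[OF J(1,4)] by auto
  have "0 < nvol J"
    using nvol_pos[OF J(1,4)] .
  have "affine_rel S u"
    using u by (simp add: conformal_def)
  then have "affine_rel C u"
    using affine_rel_mono_neutral[OF \<open>finite S\<close> C(2), of u] by (auto simp: C_def)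
  note bary = affine_rel_barycentric[OF C(1) this C(3) p(2)]
  define \<beta> where "\<beta> v = (if v \<in> I then - u v / u p else 0)" for v
  have "sum \<beta> J = sum \<beta> I"
    by (rule sum.mono_neutral_right) (use cardJ(1) J(2) in \<open>auto simp: \<beta>_def\<close>)
  moreover have "(\<Sum>v\<in>J. \<beta> v *\<^sub>R v) = (\<Sum>v\<in>I. \<beta> v *\<^sub>R v)"
    by (rule sum.mono_neutral_right) (use cardJ(1) J(2) in \<open>auto simp: \<beta>_def\<close>)
  ultimately have \<beta>: "sum \<beta> J = 1" "(\<Sum>v\<in>J. \<beta> v *\<^sub>R v) = p"
    using bary by (simp_all add: \<beta>_def I_def)
  \<comment> \<open>Needed for \<open>insert p (J - {v})\<close> to have \<open>d + 1\<close>
    points. If \<open>p\<close> were in \<open>J\<close>, then \<open>\<beta>\<close>, which gives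
    \<open>p\<close> weight 0, would be a second barycentric representation of
    \<open>p\<close>.\<close>
  have "p \<notin> J"
  proof
    assume "p \<in> J"
    define U where "U v = \<beta> v - (if v = p then 1 else 0)" for v
    have "(\<Sum>v\<in>J. U v *\<^sub>R v) = (\<Sum>v\<in>J. \<beta> v *\<^sub>R v - (if v = p then p else 0))"
      by (intro sum.cong) (auto simp: U_def scaleR_diff_left)
    then have "(\<Sum>v\<in>J. U v *\<^sub>R v) = 0" "sum U J = 0"
      using \<beta> cardJ(1) \<open>p \<in> J\<close> by (simp_all add: U_def sum_subtractf)
    moreover have "U p \<noteq> 0"
      by (simp add: U_def \<beta>_def I_def)
    ultimately show False
      using J(1) \<open>p \<in> J\<close> affine_dependent_explicit_finite[OF cardJ(1)] by blast
  qed
  define e where "e v = nvol J / \<bar>u p\<bar> * u v" for v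
  have val: "\<exists>K\<subseteq>V. card K = CARD('n) + 1 \<and> \<bar>e v\<bar> = nvol K" if v: "v \<in> C" for v
  proof (cases "v = p")
    case True
    then show ?thesis
      using J(3) cardJ(2) p(2) nvol_nonneg[of J] by (intro exI[of _ J]) (simp add: e_def abs_mult)
  next
    case False
    then have vI: "v \<in> I"
      using v by (simp add: I_def)
    have "\<bar>e v\<bar> = \<bar>\<beta> v\<bar> * nvol J"
      using vI nvol_nonneg[of J] by (simp add: e_def \<beta>_def abs_mult)
    also have "\<dots> = nvol (insert p (J - {v}))"
      using nvol_replace[OF cardJ(2) _ \<beta>] vI J(2) by auto
    finally have "\<bar>e v\<bar> = nvol (insert p (J - {v}))" .
    moreover have "card (insert p (J - {v})) = CARD('n) + 1"
      using cardJ \<open>p \<notin> J\<close> vI J(2) by (auto simp: card_Diff_singleton)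
    moreover have "insert p (J - {v}) \<subseteq> V"
      using J(3) p(1) S by auto
    ultimately show ?thesis
      by blast
  qed
  show thesis
  proof (rule that)
    have "(\<Sum>v\<in>S. e v *\<^sub>R v) = (nvol J / \<bar>u p\<bar>) *\<^sub>R (\<Sum>v\<in>S. u v *\<^sub>R v)"
      by (simp add: e_def scaleR_sum_right)
    moreover have "sum e S = (nvol J / \<bar>u p\<bar>) * sum u S"
      by (simp add: e_def[abs_def] sum_distrib_left)
    ultimately have "affine_rel S e"
      using \<open>affine_rel S u\<close> by (simp add: affine_rel_def)
    moreover have "0 \<le> e v * z v \<and> (z v = 0 \<longrightarrow> e v = 0)" if "v \<in> S" for v
    proof -
      have "0 \<le> u v * z v" "z v = 0 \<longrightarrow> u v = 0"
        using u that by (auto simp: conformal_def)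
      moreover have "e v * z v = (nvol J / \<bar>u p\<bar>) * (u v * z v)"
        by (simp add: e_def)
      moreover have "0 \<le> nvol J / \<bar>u p\<bar>"
        using nvol_nonneg[of J] by simp
      ultimately have "0 \<le> e v * z v"
        by (metis mult_nonneg_nonneg)
      then show ?thesis
        using \<open>z v = 0 \<longrightarrow> u v = 0\<close> by (simp add: e_def)
    qed
    moreover have "e p \<noteq> 0"
      using p(2) \<open>0 < nvol J\<close> by (simp add: e_def)
    ultimately show "conformal S e z"
      using p(1) by (auto simp: conformal_def)
  next
    fix v assume v: "v \<in> S"
    show "e v \<in> \<int>"
    proof (cases "v \<in> C")
      case True
      then have "\<bar>e v\<bar> \<in> \<int>"
        using val nvol_Ints V(2) by (metis subset_trans)
      then show ?thesis
        by (auto simp: abs_if split: if_splits)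
    qed (use v in \<open>auto simp: e_def C_def\<close>)
    show "\<bar>e v\<bar> \<le> W"
    proof (cases "v \<in> C")
      case True
      then show ?thesis
        using val W by metis
    next
      case False
      then show ?thesis
        using v W[OF J(3) cardJ(2)] nvol_nonneg[of J] by (auto simp: e_def C_def)
    qed
  qed
qed

text \<open>Greedy conformal decomposition: subtracting the largest admissible multiple \<open>t\<close> of a circuit
  from \<open>z\<close> removes one point from the support.  Either \<open>t \<ge> 1\<close> occurs at some stage, or the sum
  of at most \<open>card S - aff_dim S - 1\<close> terms of size at most \<open>W\<close> remains.\<close>

lemma conformal_or_bounded:
  fixes V :: "(real^'n) set"
  assumes V: "finite V" "V \<subseteq> int_lattice" "affine hull V = UNIV"
    and W: "\<And>J. J \<subseteq> V \<Longrightarrow> card J = CARD('n) + 1 \<Longrightarrow> nvol J \<le> W" and "0 \<le> W"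
  assumes "S \<subseteq> V" "affine_rel S z"
  shows "(\<exists>e. conformal S e z \<and> (\<forall>v\<in>S. e v \<in> \<int> \<and> \<bar>e v\<bar> \<le> \<bar>z v\<bar>)) \<or>
    (\<forall>v\<in>S. \<bar>z v\<bar> \<le> W * (real (card S) - of_int (aff_dim S) - 1))"
  using assms(6,7)
proof (induction "card S" arbitrary: S z rule: less_induct)
  case less
  define k where "k S = real (card S) - of_int (aff_dim S) - 1" for S :: "(real^'n) set"
  have k_nonneg: "0 \<le> k T" if "T \<subseteq> V" for T
    using aff_dim_le_card[of T] V(1) finite_subset[OF that] by (simp add: k_def)
  have "finite S"
    using less.prems(1) V(1) finite_subset by blast
  show ?case
  proof (cases "\<exists>v\<in>S. z v \<noteq> 0")
    case False
    then show ?thesis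
      using k_nonneg[OF less.prems(1)] \<open>0 \<le> W\<close> by (simp add: k_def)
  next
    case True
    then obtain e where e: "conformal S e z" "\<And>v. v \<in> S \<Longrightarrow> e v \<in> \<int>" "\<And>v. v \<in> S \<Longrightarrow> \<bar>e v\<bar> \<le> W"
      using integral_conformal[OF V W less.prems] by blast
    have ez: "0 \<le> e v * z v" "z v = 0 \<Longrightarrow> e v = 0" if "v \<in> S" for v
      using e(1) that by (auto simp: conformal_def)
    define P where "P = {v\<in>S. e v \<noteq> 0}"
    define t where "t = Min ((\<lambda>v. z v / e v) ` P)"
    have P: "finite P" "P \<noteq> {}"
      using \<open>finite S\<close> e(1) by (auto simp: P_def conformal_def)
    then have "t \<in> (\<lambda>v. z v / e v) ` P"
      unfolding t_def by (intro Min_in) auto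
    then obtain r where r: "r \<in> P" "t = z r / e r"
      by blast
    have quot: "z v / e v = \<bar>z v\<bar> / \<bar>e v\<bar>" if "v \<in> P" for v
      using that ez[of v] by (auto simp: P_def zero_le_mult_iff)
    have "0 \<le> t"
      using r quot by simp
    have le: "t * \<bar>e v\<bar> \<le> \<bar>z v\<bar>" if "v \<in> S" for v
    proof (cases "v \<in> P")
      case True
      then have "t \<le> z v / e v"
        using P(1) by (simp add: t_def)
      then have "t \<le> \<bar>z v\<bar> / \<bar>e v\<bar>"
        using quot[OF True] by simp
      then show ?thesis
        using True by (simp add: P_def field_simps)
    qed (use that in \<open>simp add: P_def\<close>)
    show ?thesis
    proof (cases "1 \<le> t")
      case True
      have "\<bar>e v\<bar> \<le> \<bar>z v\<bar>" if "v \<in> S" for v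
        using le[OF that] mult_right_mono[OF True, of "\<bar>e v\<bar>"] by simp
      then show ?thesis
        using e by blast
    next
      case False
      define y where "y v = z v - t * e v" for v
      \<comment> \<open>Coordinates of \<open>y\<close> are those of \<open>z\<close> scaled by
        factors in [0,1], so a relation conformal to \<open>y\<close> and dominated by it has both
        properties for \<open>z\<close> as well.\<close>
      have shrink: "\<exists>c. 0 \<le> c \<and> c \<le> 1 \<and> y v = c * z v" if v: "v \<in> S" for v
      proof (cases "z v = 0")
        case True
        then show ?thesis
          using ez[OF v] by (intro exI[of _ 1]) (simp add: y_def)
      next
        case z0: False
        define q where "q = t * \<bar>e v\<bar> / \<bar>z v\<bar>"
        have "t * e v = q * z v"
          using z0 ez[OF v] by (auto simp: q_def zero_le_mult_iff)
        then have "y v = (1 - q) * z v"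
          by (simp add: y_def algebra_simps)
        moreover have "0 \<le> q" "q \<le> 1"
          using le[OF v] z0 \<open>0 \<le> t\<close> by (simp_all add: q_def)
        ultimately show ?thesis
          by (intro exI[of _ "1 - q"]) simp
      qed
      define T where "T = S - {r}"
      have rS: "r \<in> S" "e r \<noteq> 0"
        using r(1) by (auto simp: P_def)
      have yr: "y r = 0"
        using r(2) rS by (simp add: y_def)
      have T: "T \<subseteq> S" "T \<subseteq> V" "finite T" "S = insert r T" "r \<notin> T"
        using less.prems(1) \<open>finite S\<close> rS by (auto simp: T_def)
      have "affine_rel S e"
        using e(1) by (simp add: conformal_def)
      then have "affine_rel S y"
        using affine_rel_diff[OF less.prems(2)] by (simp add: y_def[abs_def])
      then have yT: "affine_rel T y"
        using affine_rel_mono_neutral[OF \<open>finite S\<close> T(1), of y] yr T(4) by auto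
      \<comment> \<open>The relation \<open>e\<close> expresses \<open>r\<close> by the other
        points. Removing \<open>r\<close> thus keeps the affine dimension, and the factor of
        \<open>W\<close> in the bound drops by exactly 1, which pays for the subtracted
        term.\<close>
      have "r \<in> affine hull T"
        using affine_rel_barycentric[OF \<open>finite S\<close> \<open>affine_rel S e\<close> rS] T(3)
        unfolding affine_hull_finite[OF T(3)]
        by (auto simp: T_def intro!: exI[of _ "\<lambda>v. - e v / e r"])
      then have "aff_dim S = aff_dim T"
        by (metis T(4) aff_dim_affine_hull hull_redundant)
      then have kT: "k S = k T + 1"
        using T(3-5) by (simp add: k_def)
      have "card T < card S"
        using T(3-5) by simp
      from less.hyps[OF this T(2) yT] consider
          (int) d where "conformal T d y" "\<And>v. v \<in> T \<Longrightarrow> d v \<in> \<int> \<and> \<bar>d v\<bar> \<le> \<bar>y v\<bar>"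
        | (bd) "\<And>v. v \<in> T \<Longrightarrow> \<bar>y v\<bar> \<le> W * k T"
        unfolding k_def by blast
      then show ?thesis
      proof cases
        case int
        define d' where "d' v = (if v = r then 0 else d v)" for v
        have "d' v = d v" if "v \<in> T" for v
          using that T(5) by (auto simp: d'_def)
        then have "sum d' T = sum d T" "(\<Sum>v\<in>T. d' v *\<^sub>R v) = (\<Sum>v\<in>T. d v *\<^sub>R v)"
          by simp_all
        then have "affine_rel T d'"
          using int(1) by (simp add: conformal_def affine_rel_def)
        then have "affine_rel S d'"
          by (subst affine_rel_mono_neutral[OF \<open>finite S\<close> T(1)]) (auto simp: d'_def T(4))
        moreover have "\<exists>v\<in>S. d' v \<noteq> 0"
          using int(1) T(4,5) by (auto simp: conformal_def d'_def)
        moreover have "0 \<le> d' v * z v \<and> (z v = 0 \<longrightarrow> d' v = 0) \<and> d' v \<in> \<int> \<and> \<bar>d' v\<bar> \<le> \<bar>z v\<bar>"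
          if v: "v \<in> S" for v
        proof (cases "v = r")
          case False
          then have "v \<in> T"
            using v T(4) by auto
          then have d: "0 \<le> d v * y v" "y v = 0 \<longrightarrow> d v = 0" "d v \<in> \<int>" "\<bar>d v\<bar> \<le> \<bar>y v\<bar>"
            using int by (auto simp: conformal_def)
          obtain c where c: "0 \<le> c" "c \<le> 1" "y v = c * z v"
            using shrink[OF v] by blast
          have "\<bar>y v\<bar> \<le> \<bar>z v\<bar>"
            using c by (simp add: abs_mult mult_left_le_one_le)
          moreover have "0 \<le> d v * z v"
            using d(1,2) c by (cases "c = 0") (auto simp: zero_le_mult_iff mult_le_0_iff)
          moreover have "z v = 0 \<longrightarrow> d v = 0"
            using d(2) c(3) by simp
          ultimately show ?thesis
            using d(3,4) False by (auto simp: d'_def)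
        qed (simp add: d'_def)
        ultimately show ?thesis
          unfolding conformal_def by blast
      next
        case bd
        have "\<bar>z v\<bar> \<le> W * k S" if v: "v \<in> S" for v
        proof -
          have "\<bar>y v\<bar> \<le> W * k T"
            using bd v T(4) yr k_nonneg[OF T(2)] \<open>0 \<le> W\<close> by (cases "v = r") auto
          moreover have "\<bar>t * e v\<bar> \<le> W"
            using False \<open>0 \<le> t\<close> e(3)[OF v] mult_mono[of t 1 "\<bar>e v\<bar>" W]
            by (simp add: abs_mult)
          moreover have "\<bar>z v\<bar> \<le> \<bar>y v\<bar> + \<bar>t * e v\<bar>"
            by (simp add: y_def)
          ultimately show ?thesis
            by (simp add: kT distrib_left)
        qed
        then show ?thesis
          by (simp add: k_def)
      qed
    qed
  qed
qed

section \<open>Integral representations close to real ones\<close>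

text \<open>The form in which membership of \<open>N v0 - x\<close> in the sums of
  \<open>v0 - A\<close> is used. The represented point and the coefficient sum are tracked
  separately, by \<open>affine_rel\<close>.\<close>

definition near_rep :: "(real^'n) set \<Rightarrow> real^'n \<Rightarrow> (real^'n \<Rightarrow> real) \<Rightarrow> bool" where
  "near_rep V v0 m \<longleftrightarrow> (\<forall>v\<in>V. m v \<in> \<int>) \<and> (\<forall>v\<in>V - {v0}. 0 \<le> m v)"

lemma near_rep_sum_nonneg: "near_rep V v0 m \<Longrightarrow> S \<subseteq> V - {v0} \<Longrightarrow> 0 \<le> sum m S"
  by (auto simp: near_rep_def intro!: sum_nonneg)

lemma near_rep_sum_Ints: "near_rep V v0 m \<Longrightarrow> S \<subseteq> V \<Longrightarrow> sum m S \<in> \<int>"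
  by (auto simp: near_rep_def intro!: Ints_sum)

lemma Ints_nonneg_less_imp:
  fixes x y :: real
  assumes "x \<in> \<int>" "y \<in> \<int>" "0 \<le> x" "x < y"
  shows "nat \<lfloor>x\<rfloor> < nat \<lfloor>y\<rfloor>"
proof -
  obtain a b where "x = of_int a" "y = of_int b"
    using assms(1,2) by (auto elim!: Ints_cases)
  then show ?thesis
    using assms(3,4) by simp
qed

text \<open>Since \<open>S\<close> avoids \<open>v0\<close>, \<open>sum w S\<close> is a nonnegative
  integer for every admissible \<open>w\<close>, so a minimum exists.\<close>

lemma near_rep_minimal:
  fixes V :: "(real^'n) set"
  assumes "near_rep V v0 m" "S \<subseteq> V - {v0}"
  obtains m' where "near_rep V v0 m'" "affine_rel V (\<lambda>v. m' v - m v)"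
    "\<And>w. near_rep V v0 w \<Longrightarrow> affine_rel V (\<lambda>v. w v - m' v) \<Longrightarrow> sum m' S \<le> sum w S"
proof -
  define Q where "Q w \<longleftrightarrow> near_rep V v0 w \<and> affine_rel V (\<lambda>v. w v - m v)" for w
  have "Q m"
    using assms(1) by (simp add: Q_def affine_rel_def)
  then obtain m' where m': "Q m'" and min: "\<And>w. Q w \<Longrightarrow> nat \<lfloor>sum m' S\<rfloor> \<le> nat \<lfloor>sum w S\<rfloor>"
    using ex_has_least_nat[of Q m "\<lambda>w. nat \<lfloor>sum w S\<rfloor>"] by blast
  show thesis
  proof (rule that)
    show "near_rep V v0 m'" "affine_rel V (\<lambda>v. m' v - m v)"
      using m' by (auto simp: Q_def)
    fix w assume w: "near_rep V v0 w" "affine_rel V (\<lambda>v. w v - m' v)"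
    have "affine_rel V (\<lambda>v. (w v - m' v) - (- 1) * (m' v - m v))"
      using w(2) m' by (intro affine_rel_diff) (auto simp: Q_def)
    then have "Q w"
      using w(1) by (simp add: Q_def)
    then have "\<not> nat \<lfloor>sum w S\<rfloor> < nat \<lfloor>sum m' S\<rfloor>"
      using min[of w] by linarith
    moreover have "S \<subseteq> V"
      using assms(2) by blast
    ultimately show "sum m' S \<le> sum w S"
      using Ints_nonneg_less_imp[of "sum w S" "sum m' S"] m' w(1) near_rep_sum_Ints
        near_rep_sum_nonneg[OF w(1) assms(2)] by (meson Q_def not_le)
  qed
qed

text \<open>Minimize the weight of \<open>m'\<close> outside \<open>insert v0 B\<close>, where
  \<open>c\<close> vanishes. An integral relation \<open>e\<close> conformal to
  \<open>z = m' - c\<close> and dominated by it could be subtracted from \<open>m'\<close>, lowering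
  this weight; so the second alternative of \<open>conformal_or_bounded\<close> holds and bounds
  \<open>z\<close> at \<open>v0\<close>.\<close>

lemma near_rep_proximity:
  fixes V :: "(real^'n) set"
  assumes V: "finite V" "V \<subseteq> int_lattice" "affine hull V = UNIV"
    and W: "\<And>J. J \<subseteq> V \<Longrightarrow> card J = CARD('n) + 1 \<Longrightarrow> nvol J \<le> W" and "0 \<le> W"
    and v0: "v0 \<in> V" and B: "B \<subseteq> V" "\<not> affine_dependent (insert v0 B)"
    and m: "near_rep V v0 m"
    and c: "\<And>v. v \<in> V - {v0} \<Longrightarrow> 0 \<le> c v" "\<And>v. v \<in> V - insert v0 B \<Longrightarrow> c v = 0"
    and mc: "affine_rel V (\<lambda>v. m v - c v)"
  obtains m' where "near_rep V v0 m'" "affine_rel V (\<lambda>v. m' v - m v)"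
    "c v0 - W * (real (card V) - real CARD('n) - 1) \<le> m' v0"
proof -
  define S where "S = V - insert v0 B"
  obtain m' where m': "near_rep V v0 m'" "affine_rel V (\<lambda>v. m' v - m v)"
    and min: "\<And>w. near_rep V v0 w \<Longrightarrow> affine_rel V (\<lambda>v. w v - m' v) \<Longrightarrow> sum m' S \<le> sum w S"
    using near_rep_minimal[OF m, of S] by (auto simp: S_def)
  define z where "z v = m' v - c v" for v
  have "affine_rel V (\<lambda>v. (m' v - m v) - (- 1) * (m v - c v))"
    using m'(2) mc by (rule affine_rel_diff)
  then have z: "affine_rel V z"
    by (simp add: z_def[abs_def])
  have "aff_dim V = int CARD('n)"
    using V(3) aff_dim_eq_full[of V] by simp
  with conformal_or_bounded[OF V W \<open>0 \<le> W\<close> subset_refl z] consider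
      (int) e where "conformal V e z" "\<And>v. v \<in> V \<Longrightarrow> e v \<in> \<int> \<and> \<bar>e v\<bar> \<le> \<bar>z v\<bar>"
    | (bd) "\<And>v. v \<in> V \<Longrightarrow> \<bar>z v\<bar> \<le> W * (real (card V) - real CARD('n) - 1)"
    by (metis of_int_of_nat_eq)
  then show thesis
  proof cases
    case int
    have e: "affine_rel V e" "\<exists>v\<in>V. e v \<noteq> 0"
      using int(1) by (auto simp: conformal_def)
    have eS: "0 \<le> e v" if "v \<in> S" for v
    proof -
      have "0 \<le> z v" "0 \<le> e v * z v" "z v = 0 \<longrightarrow> e v = 0"
        using that c(2)[of v] m'(1) int(1) by (auto simp: S_def z_def near_rep_def conformal_def)
      then show ?thesis
        by (auto simp: zero_le_mult_iff)
    qed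
    \<comment> \<open>A nonzero relation cannot live on the affinely independent set
      \<open>insert v0 B\<close> alone.\<close>
    have "\<exists>v\<in>S. e v \<noteq> 0"
    proof (rule ccontr)
      assume "\<not> (\<exists>v\<in>S. e v \<noteq> 0)"
      then have e0: "e v = 0" if "v \<in> V - insert v0 B" for v
        using that by (auto simp: S_def)
      have fin: "finite (insert v0 B)" "insert v0 B \<subseteq> V"
        using V(1) B(1) v0 finite_subset by auto
      have "affine_rel (insert v0 B) e"
        using affine_rel_mono_neutral[OF V(1) fin(2), of e] e0 e(1) by blast
      moreover have "\<exists>v\<in>insert v0 B. e v \<noteq> 0"
        using e(2) e0 by blast
      ultimately show False
        using B(2) affine_dependent_explicit_finite[OF fin(1)] by (auto simp: affine_rel_def)
    qed
    then have "0 < sum e S"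
      using eS V(1) by (metis S_def finite_Diff less_eq_real_def sum_pos2)
    define w where "w v = m' v - e v" for v
    have "near_rep V v0 w"
      unfolding near_rep_def
    proof (intro conjI ballI)
      fix v assume "v \<in> V"
      then show "w v \<in> \<int>"
        using m'(1) int(2) by (simp add: w_def near_rep_def)
    next
      fix v assume v: "v \<in> V - {v0}"
      have "0 \<le> c v" "0 \<le> m' v"
        using c(1) v m'(1) by (auto simp: near_rep_def)
      moreover have "0 \<le> e v * z v" "z v = 0 \<longrightarrow> e v = 0" "\<bar>e v\<bar> \<le> \<bar>z v\<bar>"
        using int v by (auto simp: conformal_def)
      \<comment> \<open>If \<open>z v\<close> is nonnegative, then
        \<open>e v \<le> z v \<le> m' v\<close> because \<open>c v\<close> is nonnegative; otherwise
        \<open>e v \<le> 0\<close>.\<close>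
      ultimately show "0 \<le> w v"
        by (auto simp: w_def z_def zero_le_mult_iff)
    qed
    moreover have "affine_rel V (\<lambda>v. w v - m' v)"
      using affine_rel_diff[of V "\<lambda>v. 0" e 1] e(1) by (simp add: w_def affine_rel_def)
    ultimately have "sum m' S \<le> sum w S"
      by (rule min)
    then show thesis
      using \<open>0 < sum e S\<close> by (simp add: w_def sum_subtractf)
  next
    case bd
    then show thesis
      using that[OF m'] v0 by (force simp: z_def)
  qed
qed

subsection \<open>Pulling triangulations\<close>

text \<open>Follow the ray from \<open>v\<close> through \<open>p\<close> to its last point in
  \<open>Q\<close>. The smallest face \<open>G\<close> containing that point cannot contain
  \<open>v\<close>, and as an intersection of facets it lies in one that misses
  \<open>v\<close>.\<close>

lemma exit_facet:
  fixes Q :: "'a::euclidean_space set"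
  assumes Q: "polytope Q" and v: "v \<in> Q" and p: "p \<in> Q" "p \<noteq> v"
  obtains F f t where "F facet_of Q" "v \<notin> F" "f \<in> F" "0 < t" "t \<le> 1" "p = (1 - t) *\<^sub>R v + t *\<^sub>R f"
proof -
  define g where "g s = v + s *\<^sub>R (p - v)" for s :: real
  define I where "I = {s. 0 \<le> s \<and> g s \<in> Q}"
  have "closed (g -` Q)"
    using polytope_imp_closed[OF Q] unfolding g_def by (intro closed_vimage continuous_intros)
  then have "closed I"
    unfolding I_def using closed_Int[of "{0..}" "g -` Q"] by (simp add: vimage_def Int_def)
  obtain C where C: "\<And>x. x \<in> Q \<Longrightarrow> norm x \<le> C"
    using polytope_imp_bounded[OF Q] by (auto simp: bounded_iff)
  have "s \<le> (C + norm v) / norm (p - v)" if "s \<in> I" for s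
  proof -
    have "s * norm (p - v) = norm (g s - v)"
      using that by (simp add: g_def I_def)
    also have "\<dots> \<le> norm (g s) + norm v"
      by (rule norm_triangle_ineq4)
    also have "\<dots> \<le> C + norm v"
      using C that by (simp add: I_def)
    finally show ?thesis
      using p(2) by (simp add: field_simps)
  qed
  then have bdd: "bdd_above I"
    by (meson bdd_aboveI)
  have "1 \<in> I"
    using p(1) by (simp add: I_def g_def)
  define s where "s = Sup I"
  have "s \<in> I"
    unfolding s_def using closed_contains_Sup \<open>1 \<in> I\<close> bdd \<open>closed I\<close> by blast
  have max: "r \<le> s" if "r \<in> I" for r
    unfolding s_def using bdd that by (rule cSup_upper[rotated])
  have "1 \<le> s"
    using max \<open>1 \<in> I\<close> .
  define \<G> where "\<G> = {G. G face_of Q \<and> g s \<in> G}"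
  have "finite \<G>"
    using finite_polytope_faces[OF Q] by (simp add: \<G>_def)
  moreover have "Q \<in> \<G>"
    using \<open>s \<in> I\<close> polytope_imp_convex[OF Q] by (simp add: \<G>_def I_def face_of_refl)
  ultimately obtain G where "G \<in> \<G>" and Gmin: "\<And>H. H \<in> \<G> \<Longrightarrow> H \<subseteq> G \<Longrightarrow> H = G"
    by (metis finite_has_minimal empty_iff)
  then have G: "G face_of Q" "g s \<in> G"
    by (auto simp: \<G>_def)
  have "polytope G"
    using face_of_polytope_polytope[OF Q G(1)] .
  have "g s \<in> rel_interior G"
  proof (rule ccontr)
    assume "g s \<notin> rel_interior G"
    then obtain H where "H facet_of G" "g s \<in> H"
      using G(2) rel_boundary_of_polyhedron[OF polytope_imp_polyhedron[OF \<open>polytope G\<close>]] by blast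
    then have H: "H face_of G" "g s \<in> H" "aff_dim H = aff_dim G - 1"
      by (auto simp: facet_of_def)
    then have "H = G"
      using Gmin[of H] face_of_trans[OF H(1) G(1)] face_of_imp_subset by (auto simp: \<G>_def)
    then show False
      using H(3) by simp
  qed
  \<comment> \<open>The last point is in the relative interior of \<open>G\<close>; with
    \<open>v\<close> in \<open>G\<close>, the segment from \<open>v\<close> could be prolonged
    beyond it inside \<open>G\<close>.\<close>
  have "v \<notin> G"
  proof
    assume "v \<in> G"
    then obtain e where e: "1 < e" "(1 - e) *\<^sub>R v + e *\<^sub>R g s \<in> G"
      using \<open>g s \<in> rel_interior G\<close> convex_rel_interior_iff[of G "g s"] face_of_imp_convex[OF G(1)]
      by blast
    have "(1 - e) *\<^sub>R v + e *\<^sub>R g s = g (e * s)"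
      by (simp add: g_def algebra_simps)
    then have "e * s \<in> I"
      using e G(1) face_of_imp_subset \<open>1 \<le> s\<close> by (auto simp: I_def)
    then show False
      using max[of "e * s"] e(1) \<open>1 \<le> s\<close> by (simp add: mult_le_cancel_right1)
  qed
  then have "G \<noteq> Q" "G \<noteq> {}"
    using v G(2) by auto
  then have "G = \<Inter> {F. F facet_of Q \<and> G \<subseteq> F}"
    using face_of_polyhedron[OF polytope_imp_polyhedron[OF Q] G(1)] by blast
  then obtain F where F: "F facet_of Q" "G \<subseteq> F" "v \<notin> F"
    using \<open>v \<notin> G\<close> by blast
  show thesis
  proof (rule that[OF F(1,3)])
    show "g s \<in> F"
      using F(2) G(2) by blast
    show "0 < 1 / s" "1 / s \<le> 1"
      using \<open>1 \<le> s\<close> by auto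
    show "p = (1 - 1 / s) *\<^sub>R v + (1 / s) *\<^sub>R g s"
      using \<open>1 \<le> s\<close> by (simp add: g_def algebra_simps)
  qed
qed

text \<open>Of two such points on one ray, the nearer would lie in the open segment from
  \<open>v\<close> to the farther, and its face would then contain \<open>v\<close>.\<close>

lemma exit_point_unique:
  fixes Q :: "'a::euclidean_space set"
  assumes F: "F face_of Q" "v \<notin> F" "f \<in> F" and F': "F' face_of Q" "v \<notin> F'" "f' \<in> F'"
    and "v \<in> Q" and t: "0 < t" "0 < t'" and eq: "t *\<^sub>R (f - v) = t' *\<^sub>R (f' - v)"
  shows "f = f'"
proof -
  have aux: "t \<le> t'" if F: "F face_of Q" "v \<notin> F" "f \<in> F" and F': "f' \<in> Q"
    and t: "0 < t" "0 < t'" and eq: "t *\<^sub>R (f - v) = t' *\<^sub>R (f' - v)"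
    for F f f' and t t' :: real
  proof (rule ccontr)
    assume "\<not> t \<le> t'"
    then have "t' / t < 1" "0 < t' / t"
      using t by auto
    moreover have "f - v = (t' / t) *\<^sub>R (f' - v)"
      using arg_cong[OF eq, of "\<lambda>x. (1 / t) *\<^sub>R x"] t(1) by simp
    then have f: "f = (1 - t' / t) *\<^sub>R v + (t' / t) *\<^sub>R f'"
      by (simp add: algebra_simps)
    moreover have "f' \<noteq> v"
    proof
      assume "f' = v"
      then have "f = v" using eq t by simp
      then show False using F by simp
    qed
    ultimately have "f \<in> open_segment v f'"
      by (auto simp: in_segment)
    then show False
      using F face_ofD[OF F(1)] F' \<open>v \<in> Q\<close> by blast
  qed
  have "f \<in> Q" "f' \<in> Q"
    using F F' face_of_imp_subset by auto
  then have "t = t'"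
    using aux[OF F _ t eq] aux[OF F' _ t(2,1) eq[symmetric]] by simp
  then show ?thesis
    using eq t by simp
qed

text \<open>Cone the triangulations of the facets not containing a fixed vertex \<open>v\<close> from \<open>v\<close>.\<close>

lemma pulling_triangulation:
  fixes Q :: "'a::euclidean_space set"
  assumes "polytope Q"
  shows "\<exists>\<T>. finite \<T> \<and>
    (\<forall>T\<in>\<T>. T \<subseteq> {v. v extreme_point_of Q} \<and> \<not> affine_dependent T \<and> aff_dim T = aff_dim Q) \<and>
    Q \<subseteq> (\<Union>T\<in>\<T>. convex hull T) \<and>
    pairwise (\<lambda>T T'. aff_dim (convex hull T \<inter> convex hull T') < aff_dim Q) \<T>"
  using assms
\<comment> \<open>The shift by 1 accounts for the empty polytope, of dimension -1.\<close>
proof (induction "nat (aff_dim Q + 1)" arbitrary: Q rule: less_induct)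
  case less
  let ?ext = "\<lambda>Q. {v. v extreme_point_of Q}"
  let ?tri = "\<lambda>Q \<T>. finite \<T> \<and>
    (\<forall>T\<in>\<T>. T \<subseteq> ?ext Q \<and> \<not> affine_dependent T \<and> aff_dim T = aff_dim Q) \<and>
    Q \<subseteq> (\<Union>T\<in>\<T>. convex hull T) \<and>
    pairwise (\<lambda>T T'. aff_dim (convex hull T \<inter> convex hull T') < aff_dim Q) \<T>"
  show ?case
  proof (cases "aff_dim Q \<le> 0")
    case True
    then have "aff_dim Q = - 1 \<or> aff_dim Q = 0"
      using aff_dim_geq[of Q] by linarith
    then consider "Q = {}" | a where "Q = {a}"
      using aff_dim_empty[of Q] aff_dim_eq_0[of Q] by blast
    then show ?thesis
    proof cases
      case 2
      then show ?thesis
        by (intro exI[of _ "{{a}}"]) (auto simp: extreme_point_of_def)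
    qed (intro exI[of _ "{}"], simp)
  next
    case False
    have Q: "Q = convex hull (?ext Q)" "convex Q"
      using Krein_Milman_Minkowski polytope_imp_compact[OF less.prems] polytope_imp_convex[OF less.prems]
      by blast+
    have "Q \<noteq> {}"
      using False by auto
    then have "?ext Q \<noteq> {}"
      using Q(1) by (metis convex_hull_empty)
    then obtain v where v: "v extreme_point_of Q"
      by blast
    then have "v \<in> Q"
      by (simp add: extreme_point_of_def)
    define \<F> where "\<F> = {F. F facet_of Q \<and> v \<notin> F}"
    have "finite \<F>"
      using finite_polytope_facets[OF less.prems] by (simp add: \<F>_def)
    have F: "F face_of Q" "aff_dim F = aff_dim Q - 1" "v \<notin> F" "polytope F" "F \<subseteq> Q" "convex F"
      if "F \<in> \<F>" for F
      using that face_of_polytope_polytope[OF less.prems]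
      by (auto simp: \<F>_def facet_of_def face_of_imp_subset face_of_imp_convex)
    have "\<exists>\<T>. ?tri F \<T>" if "F \<in> \<F>" for F
      using less.hyps[of F] F[OF that] False by force
    then obtain \<U> where \<U>: "\<And>F. F \<in> \<F> \<Longrightarrow> ?tri F (\<U> F)"
      by metis
    define \<T> where "\<T> = (\<Union>F\<in>\<F>. insert v ` \<U> F)"
    have sub: "convex hull T \<subseteq> F" if "F \<in> \<F>" "T \<in> \<U> F" for F T
    proof (rule hull_minimal)
      show "T \<subseteq> F"
        using \<U>[OF that(1)] that(2) by (auto simp: extreme_point_of_def)
      show "convex F"
        using F(6)[OF that(1)] .
    qed
    have cone: "\<exists>s f. f \<in> convex hull T \<and> 0 \<le> s \<and> x = v + s *\<^sub>R (f - v)"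
      if x: "x \<in> convex hull insert v T" "T \<noteq> {}" for x T
    proof -
      obtain a b f where "0 \<le> a" "0 \<le> b" "a + b = 1" "f \<in> convex hull T" "x = a *\<^sub>R v + b *\<^sub>R f"
        using x by (auto simp: convex_hull_insert)
      moreover from this have "a = 1 - b"
        by simp
      ultimately show ?thesis
        by (intro exI[of _ b] exI[of _ f]) (simp add: algebra_simps)
    qed
    have ne: "T \<noteq> {}" if "F \<in> \<F>" "T \<in> \<U> F" for F T
      using \<U>[OF that(1)] that(2) F(2)[OF that(1)] False by force
    have Tprops: "insert v T \<subseteq> ?ext Q \<and> \<not> affine_dependent (insert v T) \<and> aff_dim (insert v T) = aff_dim Q"
      if FT: "F \<in> \<F>" "T \<in> \<U> F" for F T
    proof (intro conjI)
      have T: "T \<subseteq> ?ext F" "\<not> affine_dependent T" "aff_dim T = aff_dim F"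
        using \<U>[OF FT(1)] FT(2) by auto
      show "insert v T \<subseteq> ?ext Q"
        using T(1) v extreme_point_of_face[OF F(1)[OF FT(1)]] by auto
      \<comment> \<open>A face is cut out of \<open>Q\<close> by its own affine hull, so the apex
        \<open>v\<close> is affinely independent of \<open>T\<close>.\<close>
      have "affine hull T \<inter> Q \<subseteq> F"
      proof -
        have "T \<subseteq> F"
          using T(1) by (auto simp: extreme_point_of_def)
        then have "affine hull T \<subseteq> affine hull F"
          by (rule hull_mono)
        then show ?thesis
          using face_of_imp_eq_affine_Int[OF Q(2) F(1)[OF FT(1)]] by blast
      qed
      then have vT: "v \<notin> affine hull T"
        using F(3)[OF FT(1)] \<open>v \<in> Q\<close> by blast
      show "\<not> affine_dependent (insert v T)"
        using affine_independent_insert[OF T(2) vT] .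
      show "aff_dim (insert v T) = aff_dim Q"
        using vT T(3) F(2)[OF FT(1)] by (simp add: aff_dim_insert)
    qed
    have "?tri Q \<T>"
    proof (intro conjI)
      show "finite \<T>"
        using \<open>finite \<F>\<close> \<U> by (simp add: \<T>_def)
      show "\<forall>T\<in>\<T>. T \<subseteq> ?ext Q \<and> \<not> affine_dependent T \<and> aff_dim T = aff_dim Q"
        using Tprops unfolding \<T>_def by blast
      have cover: "\<exists>T\<in>\<T>. p \<in> convex hull T \<and> v \<in> T" if p: "p \<in> Q" "p \<noteq> v" for p
      proof -
        obtain F f t where f: "F facet_of Q" "v \<notin> F" "f \<in> F" "0 < t" "t \<le> 1" "p = (1 - t) *\<^sub>R v + t *\<^sub>R f"
          using exit_facet[OF less.prems \<open>v \<in> Q\<close> p] by blast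
        then have "F \<in> \<F>"
          by (simp add: \<F>_def)
        then obtain T where T: "T \<in> \<U> F" "f \<in> convex hull T"
          using \<U> f(3) by blast
        have "f \<in> convex hull insert v T" "v \<in> convex hull insert v T"
          using T(2) hull_mono[of T "insert v T" convex] hull_subset[of "insert v T" convex] by auto
        then have "p \<in> convex hull insert v T"
          using f(4-6) by (simp add: convexD_alt[OF convex_convex_hull])
        then show ?thesis
          using T(1) \<open>F \<in> \<F>\<close> by (auto simp: \<T>_def)
      qed
      \<comment> \<open>The apex determines no ray; it is covered by the simplex of any other
        point.\<close>
      have "Q \<noteq> {v}"
        using False by auto
      then obtain p where "p \<in> Q" "p \<noteq> v"
        using \<open>v \<in> Q\<close> by blast
      then have "\<exists>T\<in>\<T>. v \<in> convex hull T"
        using cover by (metis hull_inc)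
      then show "Q \<subseteq> (\<Union>T\<in>\<T>. convex hull T)"
        using cover by blast
      show "pairwise (\<lambda>T T'. aff_dim (convex hull T \<inter> convex hull T') < aff_dim Q) \<T>"
        unfolding pairwise_def
      proof (intro ballI impI)
        fix X X' assume X: "X \<in> \<T>" "X' \<in> \<T>" "X \<noteq> X'"
        obtain F T where T: "F \<in> \<F>" "T \<in> \<U> F" "X = insert v T"
          using X(1) by (auto simp: \<T>_def)
        obtain F' T' where T': "F' \<in> \<F>" "T' \<in> \<U> F'" "X' = insert v T'"
          using X(2) by (auto simp: \<T>_def)
        let ?D = "convex hull T \<inter> convex hull T'"
        \<comment> \<open>The bases overlap in codimension 1 within the facet: by induction if the
          facets coincide, and otherwise because distinct facets meet in a proper face of
          each.\<close>
        have D: "aff_dim ?D < aff_dim Q - 1"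
        proof (cases "F = F'")
          case True
          then have "T \<noteq> T'"
            using X(3) T(3) T'(3) by auto
          then have "aff_dim ?D < aff_dim F"
            using \<U>[OF T(1)] T(2) T'(2) True unfolding pairwise_def by blast
          then show ?thesis
            using F(2)[OF T(1)] by simp
        next
          case False
          have FF: "F \<inter> F' face_of Q" "F \<inter> F' \<subseteq> F"
            using F(1)[OF T(1)] F(1)[OF T'(1)] by (auto simp: face_of_Int)
          have "F \<inter> F' face_of F"
            using face_of_subset[OF FF] F(5)[OF T(1)] by blast
          have "F \<inter> F' \<noteq> F"
          proof
            assume "F \<inter> F' = F"
            then have "F face_of F'"
              using face_of_subset[OF F(1)[OF T(1)], of F'] F(5)[OF T'(1)] by blast
            then have "aff_dim F < aff_dim F'"
              using face_of_aff_dim_lt[OF F(6)[OF T'(1)]] False by blast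
            then show False
              using F(2)[OF T(1)] F(2)[OF T'(1)] by simp
          qed
          then have "aff_dim (F \<inter> F') < aff_dim F"
            using face_of_aff_dim_lt[OF F(6)[OF T(1)] \<open>F \<inter> F' face_of F\<close>] by blast
          moreover have "aff_dim ?D \<le> aff_dim (F \<inter> F')"
            using sub[OF T(1,2)] sub[OF T'(1,2)] by (intro aff_dim_subset) blast
          ultimately show ?thesis
            using F(2)[OF T(1)] by simp
        qed
        \<comment> \<open>A common point other than \<open>v\<close> has the same exit point in both
          cones, so it lies on a ray through the overlap of the bases. Coning raises the dimension
          by at most 1.\<close>
        have "convex hull X \<inter> convex hull X' \<subseteq> affine hull (insert v ?D)"
        proof
          fix x assume x: "x \<in> convex hull X \<inter> convex hull X'"
          show "x \<in> affine hull (insert v ?D)"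
          proof (cases "x = v")
            case True
            then show ?thesis by (simp add: hull_inc)
          next
            case xv: False
            obtain s f where f: "f \<in> convex hull T" "0 \<le> s" "x = v + s *\<^sub>R (f - v)"
              using cone[of x T] x T(3) ne[OF T(1,2)] by auto
            obtain s' f' where f': "f' \<in> convex hull T'" "0 \<le> s'" "x = v + s' *\<^sub>R (f' - v)"
              using cone[of x T'] x T'(3) ne[OF T'(1,2)] by auto
            have "0 < s" "0 < s'"
              using xv f(2,3) f'(2,3) by (auto simp: less_le)
            moreover have "s *\<^sub>R (f - v) = s' *\<^sub>R (f' - v)"
              using f(3) f'(3) by simp
            ultimately have "f = f'"
              using exit_point_unique[OF F(1)[OF T(1)] F(3)[OF T(1)] _ F(1)[OF T'(1)] F(3)[OF T'(1)] _ \<open>v \<in> Q\<close>]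
                sub[OF T(1,2)] sub[OF T'(1,2)] f(1) f'(1) by blast
            then have "f \<in> ?D"
              using f(1) f'(1) by blast
            then have "f \<in> affine hull (insert v ?D)" "v \<in> affine hull (insert v ?D)"
              by (auto intro: hull_inc)
            moreover have "x = (1 - s) *\<^sub>R v + s *\<^sub>R f"
              using f(3) by (simp add: algebra_simps)
            ultimately show ?thesis
              using mem_affine[OF affine_affine_hull, of v _ f "1 - s" s] by simp
          qed
        qed
        then have "aff_dim (convex hull X \<inter> convex hull X') \<le> aff_dim (insert v ?D)"
          by (metis aff_dim_subset aff_dim_affine_hull)
        also have "\<dots> \<le> aff_dim ?D + 1"
          by (simp add: aff_dim_insert)
        finally show "aff_dim (convex hull X \<inter> convex hull X') < aff_dim Q"
          using D by simp
      qed
    qed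
    then show ?thesis
      by blast
  qed
qed

text \<open>Overlaps of lower dimension are negligible, so the volumes of the simplices add
  up.\<close>

lemma pulling_volume:
  fixes Q :: "(real^'n) set"
  assumes "polytope Q" "aff_dim Q = int CARD('n)"
  obtains \<T> where "finite \<T>" "\<And>T. T \<in> \<T> \<Longrightarrow> T \<subseteq> {v. v extreme_point_of Q}"
    "\<And>T. T \<in> \<T> \<Longrightarrow> \<not> affine_dependent T" "\<And>T. T \<in> \<T> \<Longrightarrow> affine hull T = UNIV"
    "Q \<subseteq> (\<Union>T\<in>\<T>. convex hull T)" "(\<Sum>T\<in>\<T>. nvol T) = fact CARD('n) * measure lebesgue Q"
proof -
  obtain \<T> where fin: "finite \<T>"
    and T: "\<And>T. T \<in> \<T> \<Longrightarrow> T \<subseteq> {v. v extreme_point_of Q} \<and> \<not> affine_dependent T \<and> aff_dim T = aff_dim Q"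
    and cover: "Q \<subseteq> (\<Union>T\<in>\<T>. convex hull T)"
    and pw: "pairwise (\<lambda>T T'. aff_dim (convex hull T \<inter> convex hull T') < aff_dim Q) \<T>"
    using pulling_triangulation[OF assms(1)] by blast
  have "convex hull T \<subseteq> Q" if "T \<in> \<T>" for T
    using T[OF that] polytope_imp_convex[OF assms(1)]
    by (intro hull_minimal) (auto simp: extreme_point_of_def)
  then have Q: "Q = (\<Union>T\<in>\<T>. convex hull T)"
    using cover by blast
  have "negligible (convex hull T \<inter> convex hull T')"
    if "aff_dim (convex hull T \<inter> convex hull T') < aff_dim Q" for T T' :: "(real^'n) set"
    using that assms(2) aff_dim_eq_full[of "convex hull T \<inter> convex hull T'"]
      low_dim_interior[of "convex hull T \<inter> convex hull T'"]
    by (simp add: negligible_convex_interior convex_Int)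
  then have "pairwise (\<lambda>T T'. negligible (convex hull T \<inter> convex hull T')) \<T>"
    using pw by (auto simp: pairwise_def)
  moreover have "convex hull T \<in> lmeasurable" if "T \<in> \<T>" for T
    using T[OF that] aff_independent_finite finite_imp_bounded
    by (intro measurable_convex bounded_convex_hull) auto
  ultimately have "measure lebesgue Q = (\<Sum>T\<in>\<T>. measure lebesgue (convex hull T))"
    unfolding Q using measure_negligible_finite_Union_image[OF fin] by blast
  then have "(\<Sum>T\<in>\<T>. nvol T) = fact CARD('n) * measure lebesgue Q"
    by (simp add: nvol_def sum_distrib_left)
  moreover have "affine hull T = UNIV" if "T \<in> \<T>" for T
    using T[OF that] assms(2) aff_dim_eq_full[of T] by simp
  ultimately show thesis
    using that[of \<T>] fin T cover by blast
qed

subsection \<open>Subsums in a sublattice\<close>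

text \<open>Volume count: if no two of the \<open>y i\<close> were congruent modulo the lattice \<open>M \<int>\<^sup>n\<close>, the unit cubes
  at \<open>M g + y i\<close> for \<open>g \<in> {0..<R}\<^sup>n\<close> would be disjoint inside the image under \<open>M\<close> of a cube of side
  \<open>R + O(1)\<close>.\<close>

lemma lattice_pigeonhole:
  fixes M :: "real^'n^'n" and y :: "nat \<Rightarrow> real^'n"
  assumes M: "\<And>i j. M $ i $ j \<in> \<int>" "det M \<noteq> 0"
    and y: "\<And>k. k < K \<Longrightarrow> y k \<in> int_lattice" and K: "\<bar>det M\<bar> < real K"
  obtains i j z where "i < j" "j < K" "z \<in> int_lattice" "y j - y i = M *v z"
proof (rule ccontr)
  assume "\<not> thesis"
  then have noth: "\<not> (i < j \<and> j < K \<and> z \<in> int_lattice \<and> y j - y i = M *v z)" for i j z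
    using that by blast
  have incong: "i = j" if ij: "i < K" "j < K" "z \<in> int_lattice" "y j - y i = M *v z" for i j z
  proof (rule ccontr)
    assume "i \<noteq> j"
    then consider "i < j" | "j < i" by linarith
    then show False
    proof cases
      case 2
      have "y i - y j = M *v (- z)"
        using ij(4) matrix_vector_mult_diff_distrib[of M 0 z] by (simp add: algebra_simps)
      moreover have "- z \<in> int_lattice"
        using ij(3) by (simp add: int_lattice_def)
      ultimately show False
        using noth 2 ij(1) by blast
    qed (use noth ij in blast)
  qed
  obtain N where "M ** N = mat 1" "N ** M = mat 1"
    using M(2) invertible_det_nz[of M] unfolding invertible_def by blast
  then have N: "M *v (N *v x) = x" "N *v (M *v x) = x" for x
    by (simp_all add: matrix_vector_mul_assoc)
  \<comment> \<open>The cube is open so that coordinates of two of its points differ by strictly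
    less than 1; an integral difference is then 0.\<close>
  define U :: "(real^'n) set" where "U = box 0 1"
  \<comment> \<open>The constant is independent of \<open>g\<close> and \<open>R\<close>: it bounds
    how far the pulled-back cubes stick out of the grid box of side \<open>R\<close>.\<close>
  have "\<exists>c\<ge>0. \<forall>k<K. \<forall>u\<in>U. \<forall>i. \<bar>(N *v (y k + u)) $ i\<bar> \<le> c"
  proof -
    have "bounded ((*v) N ` (\<Union>k<K. (+) (y k) ` U))"
      by (intro bounded_linear_image bounded_UN) (auto simp: U_def bounded_translation)
    then obtain c where c: "\<And>x. x \<in> (*v) N ` (\<Union>k<K. (+) (y k) ` U) \<Longrightarrow> norm x \<le> c" "0 \<le> c"
      by (meson bounded_pos less_imp_le)
    have "\<bar>(N *v (y k + u)) $ i\<bar> \<le> c" if "k < K" "u \<in> U" for k u i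
    proof -
      have "norm (N *v (y k + u)) \<le> c"
        using that by (intro c(1)) blast
      then show ?thesis
        using component_le_norm_cart order_trans by blast
    qed
    then show ?thesis
      using c(2) by blast
  qed
  then obtain c where "0 \<le> c" and c: "\<And>k u i. k < K \<Longrightarrow> u \<in> U \<Longrightarrow> \<bar>(N *v (y k + u)) $ i\<bar> \<le> c"
    by blast
  have ineq: "real K * real R ^ CARD('n) \<le> \<bar>det M\<bar> * (real R + 2 * c) ^ CARD('n)" for R :: nat
  proof -
    define G where "G = (UNIV :: 'n set) \<rightarrow>\<^sub>E {..<R}"
    define vec where "vec g = (\<chi> i. real (g i))" for g :: "'n \<Rightarrow> nat"
    define X where "X = (\<lambda>(g, k). (+) (M *v vec g + y k) ` U)"
    define I where "I = G \<times> {..<K}"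
    have "finite I" "card I = R ^ CARD('n) * K"
      by (simp_all add: I_def G_def card_PiE finite_PiE card_cartesian_product)
    have Mz: "M *v z \<in> int_lattice" if "z \<in> int_lattice" for z
      using that M(1) by (auto simp: int_lattice_def matrix_vector_mult_def intro!: Ints_sum Ints_mult)
    have disj: "X p \<inter> X q = {}" if "p \<in> I" "q \<in> I" "p \<noteq> q" for p q
    proof (rule ccontr)
      assume "X p \<inter> X q \<noteq> {}"
      obtain g k h l where pq: "p = (g, k)" "q = (h, l)" "k < K" "l < K"
        using \<open>p \<in> I\<close> \<open>q \<in> I\<close> by (auto simp: I_def)
      obtain u w where u: "u \<in> U" "w \<in> U" "M *v vec g + y k + u = M *v vec h + y l + w"
        using \<open>X p \<inter> X q \<noteq> {}\<close> by (auto simp: X_def pq)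
      have z: "vec g - vec h \<in> int_lattice"
        by (simp add: vec_def int_lattice_def)
      have eq: "w - u = M *v (vec g - vec h) + (y k - y l)"
        using u(3) by (simp add: matrix_vector_mult_diff_distrib algebra_simps)
      then have "w - u \<in> int_lattice"
        using Mz[OF z] y pq(3,4) by (auto simp: int_lattice_def)
      moreover have "\<bar>(w - u) $ i\<bar> < 1" for i
      proof -
        have "0 < u $ i" "u $ i < 1" "0 < w $ i" "w $ i < 1"
          using u(1,2) by (simp_all add: U_def mem_box_cart)
        then show ?thesis
          by (simp add: abs_less_iff)
      qed
      ultimately have "(w - u) $ i = 0" for i
        unfolding int_lattice_def by (blast intro: Ints_nonzero_abs_less1)
      then have "w - u = 0"
        by (simp add: vec_eq_iff)
      with eq have yy: "y l - y k = M *v (vec g - vec h)"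
        by (simp add: algebra_simps)
      then have "k = l"
        using incong[OF pq(3,4) z] by blast
      then have "M *v (vec g - vec h) = 0"
        using yy by simp
      then have "vec g - vec h = 0"
        using N(2)[of "vec g - vec h"] by simp
      then have "g = h"
        by (auto simp: vec_def vec_eq_iff)
      then show False
        using that(3) pq \<open>k = l\<close> by simp
    qed
    have "measure lborel U = (\<Prod>b\<in>Basis. (1 - 0 :: real^'n) \<bullet> b)"
      unfolding U_def by (rule measure_lborel_box) (auto simp: Basis_vec_def inner_axis)
    also have "\<dots> = 1"
      by (intro prod.neutral) (auto simp: Basis_vec_def inner_axis)
    finally have U: "U \<in> lmeasurable" "measure lebesgue U = 1"
      by (simp_all add: U_def)
    have Xm: "X p \<in> lmeasurable" "measure lebesgue (X p) = 1" for p
      using U by (auto simp: X_def measurable_translation measure_translation split: prod.split)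
    have "pairwise (\<lambda>p q. negligible (X p \<inter> X q)) I"
      using disj by (simp add: pairwise_def)
    then have "measure lebesgue (\<Union>(X ` I)) = (\<Sum>p\<in>I. measure lebesgue (X p))"
      using measure_negligible_finite_Union_image[OF \<open>finite I\<close>] Xm(1) by blast
    also have "\<dots> = real K * real R ^ CARD('n)"
      by (simp add: Xm(2) \<open>card I = R ^ CARD('n) * K\<close>)
    finally have vol: "measure lebesgue (\<Union>(X ` I)) = real K * real R ^ CARD('n)" .
    define B :: "(real^'n) set" where "B = cbox (\<chi> i. - c) (\<chi> i. real R + c)"
    have "B \<noteq> {}"
      using \<open>0 \<le> c\<close> by (simp add: B_def interval_ne_empty_cart)
    then have B: "B \<in> lmeasurable" "measure lebesgue B = (real R + 2 * c) ^ CARD('n)"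
      by (simp_all add: B_def content_cbox_cart algebra_simps)
    have "\<Union>(X ` I) \<subseteq> (*v) M ` B"
    proof
      fix x assume "x \<in> \<Union>(X ` I)"
      then obtain g k u where x: "g \<in> G" "k < K" "u \<in> U" "x = M *v vec g + y k + u"
        by (auto simp: X_def I_def)
      define b where "b = vec g + N *v (y k + u)"
      have "x = M *v b"
        by (simp add: b_def x(4) matrix_vector_right_distrib N)
      moreover have "b \<in> B"
      proof -
        have "- c \<le> (N *v (y k + u)) $ i \<and> (N *v (y k + u)) $ i \<le> c" for i
          using c[OF x(2,3), of i] by linarith
        moreover have "0 \<le> vec g $ i \<and> vec g $ i \<le> real R" for i
          using x(1) by (auto simp: G_def vec_def PiE_iff less_imp_le)
        ultimately have "- c \<le> b $ i \<and> b $ i \<le> real R + c" for i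
          unfolding b_def vector_add_component by (meson add_mono add_increasing)
        then show ?thesis
          by (simp add: B_def mem_box_cart)
      qed
      ultimately show "x \<in> (*v) M ` B"
        by blast
    qed
    then have "measure lebesgue (\<Union>(X ` I)) \<le> measure lebesgue ((*v) M ` B)"
      using lmeasurable_linear_image_cart[OF matrix_vector_mul_linear B(1)] Xm(1) \<open>finite I\<close>
      by (intro measure_mono_fmeasurable) (auto intro!: sets.finite_UN fmeasurableD)
    also have "\<dots> = \<bar>det M\<bar> * (real R + 2 * c) ^ CARD('n)"
      using measure_linear_image_cart[OF matrix_vector_mul_linear B(1)] B(2) by simp
    finally show ?thesis
      by (simp add: vol)
  qed
  \<comment> \<open>Divided by \<open>R ^ CARD('n)\<close>, the boundary contribution tends to 0 as
    \<open>R\<close> grows, leaving \<open>K \<le> \<bar>det M\<bar>\<close>.\<close>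
  have "(\<lambda>R. \<bar>det M\<bar> * (1 + 2 * c * inverse (real R)) ^ CARD('n)) \<longlonglongrightarrow> \<bar>det M\<bar> * (1 + 2 * c * 0) ^ CARD('n)"
    by (intro tendsto_intros lim_inverse_n)
  moreover have "eventually (\<lambda>R. real K \<le> \<bar>det M\<bar> * (1 + 2 * c * inverse (real R)) ^ CARD('n)) sequentially"
    using eventually_gt_at_top[of 0]
  proof eventually_elim
    case (elim R)
    have "(real R + 2 * c) ^ CARD('n) = (1 + 2 * c * inverse (real R)) ^ CARD('n) * real R ^ CARD('n)"
      using elim by (simp add: field_simps flip: power_mult_distrib)
    then have "real K * real R ^ CARD('n) \<le> \<bar>det M\<bar> * (1 + 2 * c * inverse (real R)) ^ CARD('n) * real R ^ CARD('n)"
      using ineq[of R] by (simp add: mult.assoc)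
    then show ?case
      using elim by (simp add: mult_le_cancel_right)
  qed
  ultimately have "real K \<le> \<bar>det M\<bar> * (1 + 2 * c * 0) ^ CARD('n)"
    by (intro tendsto_lowerbound[OF _ _ sequentially_bot])
  then show False
    using K by simp
qed

text \<open>Among the \<open>K + 1\<close> partial sums of \<open>s k - b\<close> two are congruent
  modulo the lattice spanned by the edges of \<open>T\<close> at \<open>b\<close>, which has index
  \<open>nvol T\<close>. Adding the convex coefficients of the terms in between gives nonnegative
  coefficients, and the congruence makes them integral.\<close>

lemma integral_subsum:
  fixes T :: "(real^'n) set" and s :: "nat \<Rightarrow> real^'n"
  assumes T: "\<not> affine_dependent T" "affine hull T = UNIV" "T \<subseteq> int_lattice"
    and s: "\<And>k. k < K \<Longrightarrow> s k \<in> convex hull T \<inter> int_lattice" and K: "nvol T < real K + 1"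
  obtains i j g where "i < j" "j \<le> K" "\<And>v. v \<in> T \<Longrightarrow> g v \<in> \<int> \<and> 0 \<le> g v"
    "sum g T = real (j - i)" "(\<Sum>v\<in>T. g v *\<^sub>R v) = (\<Sum>k=i..<j. s k)"
proof -
  have cT: "finite T" "card T = CARD('n) + 1"
    using card_simplex[OF T(1,2)] by auto
  then obtain b where b: "b \<in> T"
    by fastforce
  obtain v :: "'n \<Rightarrow> real^'n" where v: "inj v" "range v = T - {b}" "T = insert b (range v)"
    using simplex_enum[OF cT(2) b] .
  define M :: "real^'n^'n" where "M = (\<chi> i j. (v j - b) $ i)"
  have nM: "nvol T = \<bar>det M\<bar>"
    by (subst v(3)) (simp add: nvol_simplex M_def)
  then have det: "det M \<noteq> 0"
    using nvol_pos[OF T(1,2)] by auto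
  have "b \<in> int_lattice" "v j \<in> int_lattice" for j
    using b v(2) T(3) by auto
  then have Mint: "M $ i $ j \<in> \<int>" for i j
    by (auto simp: M_def int_lattice_def)
  define y where "y k = (\<Sum>l<k. s l - b)" for k
  have "y k \<in> int_lattice" if "k < K + 1" for k
    using s that \<open>b \<in> int_lattice\<close> by (auto simp: y_def int_lattice_def intro!: Ints_sum)
  moreover have "\<bar>det M\<bar> < real (K + 1)"
    using K nM by simp
  ultimately obtain i j z where ij: "i < j" "j < K + 1" and z: "z \<in> int_lattice" "y j - y i = M *v z"
    using lattice_pigeonhole[OF Mint det] by blast
  have "\<exists>\<beta>. (\<forall>v\<in>T. 0 \<le> \<beta> v) \<and> sum \<beta> T = 1 \<and> (\<Sum>v\<in>T. \<beta> v *\<^sub>R v) = s k" if "k < K" for k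
    using s[OF that] unfolding convex_hull_finite[OF cT(1)] by blast
  then obtain \<beta> where \<beta>: "\<And>k. k < K \<Longrightarrow> (\<forall>v\<in>T. 0 \<le> \<beta> k v) \<and> sum (\<beta> k) T = 1 \<and> (\<Sum>v\<in>T. \<beta> k v *\<^sub>R v) = s k"
    by metis
  define g where "g v = (\<Sum>k=i..<j. \<beta> k v)" for v
  have g_nonneg: "0 \<le> g v" if "v \<in> T" for v
    unfolding g_def using \<beta> that ij(2) by (intro sum_nonneg) auto
  have "sum g T = (\<Sum>k=i..<j. sum (\<beta> k) T)"
    unfolding g_def by (rule sum.swap)
  also have "\<dots> = (\<Sum>k=i..<j. 1)"
    using \<beta> ij(2) by (intro sum.cong) auto
  finally have sum_g: "sum g T = real (j - i)"
    by simp
  have "(\<Sum>v\<in>T. g v *\<^sub>R v) = (\<Sum>k=i..<j. \<Sum>v\<in>T. \<beta> k v *\<^sub>R v)"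
    unfolding g_def scaleR_sum_left by (rule sum.swap)
  also have "\<dots> = (\<Sum>k=i..<j. s k)"
    using \<beta> ij(2) by (intro sum.cong) auto
  finally have sum_gv: "(\<Sum>v\<in>T. g v *\<^sub>R v) = (\<Sum>k=i..<j. s k)" .
  have "y j - y i = (\<Sum>k=i..<j. s k - b)"
    using ij(1) sum_diff_nat_ivl[of 0 i j "\<lambda>k. s k - b"] by (simp add: y_def atLeast0LessThan)
  also have "\<dots> = (\<Sum>k=i..<j. s k) - real (j - i) *\<^sub>R b"
    by (simp add: sum_subtractf sum_constant_scaleR del: sum_constant)
  also have "\<dots> = (\<Sum>t\<in>T. g t *\<^sub>R (t - b))"
    by (simp add: scaleR_diff_right sum_subtractf sum_gv flip: scaleR_sum_left sum_g)
  also have "\<dots> = (\<Sum>t\<in>T - {b}. g t *\<^sub>R (t - b))"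
    using cT(1) by (intro sum.mono_neutral_right) auto
  also have "\<dots> = (\<Sum>l\<in>UNIV. g (v l) *\<^sub>R (v l - b))"
    unfolding v(2)[symmetric] by (simp add: sum.reindex[OF v(1)])
  also have "\<dots> = M *v (\<chi> l. g (v l))"
    by (simp add: M_def matrix_vector_mult_def vec_eq_iff mult.commute)
  finally have "M *v z = M *v (\<chi> l. g (v l))"
    using z(2) by simp
  then have "z = (\<chi> l. g (v l))"
    using det invertible_det_nz[of M] by (meson inj_matrix_vector_mult injD)
  then have gv: "g (v l) \<in> \<int>" for l
    using z(1) by (auto simp: int_lattice_def)
  then have gT: "g t \<in> \<int>" if "t \<in> T - {b}" for t
    using that unfolding v(2)[symmetric] by auto
  \<comment> \<open>The congruence says nothing about the base point; its coefficient is integral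
    because the total is \<open>j - i\<close>.\<close>
  have "g b = sum g T - sum g (T - {b})"
    using cT(1) b by (simp add: sum.remove)
  moreover have "sum g (T - {b}) \<in> \<int>"
    using gT by (intro Ints_sum) auto
  ultimately have "g b \<in> \<int>"
    by (simp add: sum_g)
  then have "g t \<in> \<int> \<and> 0 \<le> g t" if "t \<in> T" for t
    using gT g_nonneg that by (cases "t = b") auto
  then show thesis
    using that[OF ij(1) _ _ sum_g sum_gv] ij(2) by simp
qed

subsection \<open>Reduction to the vertices\<close>

text \<open>Lists a multiset as a sequence, the form required for partial sums and for
  \<open>nfold_sum\<close>; \<open>sum_by_values\<close> goes back.\<close>

lemma seq_with_multiplicities:
  assumes "finite X"
  shows "\<exists>s. (\<forall>k<sum n X. s k \<in> X) \<and> (\<forall>a\<in>X. card {k. k < sum n X \<and> s k = a} = n a)"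
  using assms
proof (induction X rule: finite_induct)
  case (insert x X)
  then obtain s where s: "\<And>k. k < sum n X \<Longrightarrow> s k \<in> X"
    "\<And>a. a \<in> X \<Longrightarrow> card {k. k < sum n X \<and> s k = a} = n a"
    by blast
  define s' where "s' k = (if k < sum n X then s k else x)" for k
  have "s' k \<in> insert x X" for k
    using s(1) by (simp add: s'_def)
  moreover have "card {k. k < sum n (insert x X) \<and> s' k = a} = n a" if "a \<in> insert x X" for a
  proof (cases "a = x")
    case True
    have "s k \<noteq> x" if "k < sum n X" for k
      using s(1)[OF that] insert.hyps(2) by auto
    then have "{k. k < sum n (insert x X) \<and> s' k = a} = {sum n X..<sum n X + n x}"
      using insert.hyps True by (auto simp: s'_def not_less split: if_splits)
    then show ?thesis
      using True by simp
  next
    case False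
    then have "{k. k < sum n (insert x X) \<and> s' k = a} = {k. k < sum n X \<and> s k = a}"
      using insert.hyps by (auto simp: s'_def)
    then show ?thesis
      using False that s(2) by simp
  qed
  ultimately show ?case
    by blast
qed simp

lemma sum_by_values:
  fixes s :: "'b \<Rightarrow> 'a::real_vector"
  assumes "finite I" "finite X" "s ` I \<subseteq> X"
  shows "(\<Sum>k\<in>I. s k) = (\<Sum>a\<in>X. real (card {k\<in>I. s k = a}) *\<^sub>R a)"
    and "card I = (\<Sum>a\<in>X. card {k\<in>I. s k = a})"
proof -
  have "(\<Sum>k\<in>I. s k) = (\<Sum>a\<in>X. \<Sum>k\<in>{k\<in>I. s k = a}. s k)"
    using sum.group[OF assms, of s] by simp
  also have "\<dots> = (\<Sum>a\<in>X. \<Sum>k\<in>{k\<in>I. s k = a}. a)"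
    by (intro sum.cong) auto
  finally show "(\<Sum>k\<in>I. s k) = (\<Sum>a\<in>X. real (card {k\<in>I. s k = a}) *\<^sub>R a)"
    by (simp add: sum_constant_scaleR del: sum_constant)
  show "card I = (\<Sum>a\<in>X. card {k\<in>I. s k = a})"
    using sum.group[OF assms, of "\<lambda>_. 1::nat"] by simp
qed

text \<open>Minimize the number of non-vertices, with multiplicity. If it exceeds the total
  normalized volume, some simplex \<open>T\<close> of the triangulation holds more than
  \<open>nvol T\<close> of them, and \<open>integral_subsum\<close> exchanges a nonempty block for
  equally many vertices of \<open>T\<close>, contradicting minimality.\<close>

lemma near_rep_vertices:
  fixes A :: "(real^'n) set"
  assumes A: "finite A" "A \<subseteq> int_lattice" "affine hull A = UNIV"
    and v0: "v0 \<in> hull_vertices A" and m: "near_rep A v0 m"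
  obtains m' where "near_rep A v0 m'" "affine_rel A (\<lambda>v. m' v - m v)"
    "sum m' (A - hull_vertices A) \<le> fact CARD('n) * measure lebesgue (convex hull A)"
proof -
  define S where "S = A - hull_vertices A"
  have S: "finite S" "S \<subseteq> A - {v0}"
    using A(1) v0 by (auto simp: S_def)
  obtain m' where m': "near_rep A v0 m'" "affine_rel A (\<lambda>v. m' v - m v)"
    and min: "\<And>w. near_rep A v0 w \<Longrightarrow> affine_rel A (\<lambda>v. w v - m' v) \<Longrightarrow> sum m' S \<le> sum w S"
    using near_rep_minimal[OF m S(2)] by blast
  have mS: "m' a \<in> \<int>" "0 \<le> m' a" if "a \<in> S" for a
    using m'(1) S(2) that by (auto simp: near_rep_def)
  have ext: "{v. v extreme_point_of convex hull A} \<subseteq> A"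
    using extreme_point_of_convex_hull by blast
  have "polytope (convex hull A)"
    using A(1) polytope_convex_hull by blast
  moreover have "aff_dim (convex hull A) = int CARD('n)"
    using A(3) aff_dim_eq_full[of A] by (simp add: aff_dim_convex_hull)
  ultimately obtain \<T> where \<T>: "finite \<T>" "\<And>T. T \<in> \<T> \<Longrightarrow> T \<subseteq> {v. v extreme_point_of convex hull A}"
    "\<And>T. T \<in> \<T> \<Longrightarrow> \<not> affine_dependent T" "\<And>T. T \<in> \<T> \<Longrightarrow> affine hull T = UNIV"
    "convex hull A \<subseteq> (\<Union>T\<in>\<T>. convex hull T)"
    "(\<Sum>T\<in>\<T>. nvol T) = fact CARD('n) * measure lebesgue (convex hull A)"
    using pulling_volume by blast
  have "sum m' S \<le> (\<Sum>T\<in>\<T>. nvol T)"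
  proof (rule ccontr)
    assume contr: "\<not> sum m' S \<le> (\<Sum>T\<in>\<T>. nvol T)"
    define X where "X T = {a\<in>S. a \<in> convex hull T}" for T
    \<comment> \<open>Only an inequality, since points on common boundaries are counted once for
      each simplex containing them.\<close>
    have "sum m' S \<le> (\<Sum>a\<in>S. \<Sum>T\<in>\<T>. if a \<in> convex hull T then m' a else 0)"
    proof (rule sum_mono)
      fix a assume a: "a \<in> S"
      then have "a \<in> convex hull A"
        by (simp add: S_def hull_inc)
      then obtain T where T: "T \<in> \<T>" "a \<in> convex hull T"
        using \<T>(5) by blast
      have "m' a = (if a \<in> convex hull T then m' a else 0)"
        using T(2) by simp
      also have "\<dots> \<le> (\<Sum>T\<in>\<T>. if a \<in> convex hull T then m' a else 0)"
        using mS(2)[OF a] by (intro member_le_sum[OF T(1)] \<T>(1)) auto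
      finally show "m' a \<le> (\<Sum>T\<in>\<T>. if a \<in> convex hull T then m' a else 0)" .
    qed
    also have "\<dots> = (\<Sum>T\<in>\<T>. sum m' (X T))"
      unfolding X_def by (subst sum.swap) (simp add: sum.inter_filter S(1))
    finally have "(\<Sum>T\<in>\<T>. nvol T) < (\<Sum>T\<in>\<T>. sum m' (X T))"
      using contr by simp
    then obtain T where T: "T \<in> \<T>" "nvol T < sum m' (X T)"
      by (meson not_le sum_mono)
    define n where "n a = nat \<lfloor>m' a\<rfloor>" for a
    have n: "real (n a) = m' a" if "a \<in> S" for a
      using mS[OF that] by (auto simp: n_def elim!: Ints_cases)
    have X: "finite (X T)" "X T \<subseteq> S"
      using S(1) by (auto simp: X_def)
    have K: "real (sum n (X T)) = sum m' (X T)"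
      using X(2) n by (auto intro!: sum.cong)
    obtain s where s: "\<And>k. k < sum n (X T) \<Longrightarrow> s k \<in> X T"
      "\<And>a. a \<in> X T \<Longrightarrow> card {k. k < sum n (X T) \<and> s k = a} = n a"
      using seq_with_multiplicities[OF X(1), of n] by blast
    have sT: "s k \<in> convex hull T \<inter> int_lattice" if "k < sum n (X T)" for k
      using s(1)[OF that] A(2) by (auto simp: X_def S_def)
    have TL: "T \<subseteq> int_lattice"
      using \<T>(2)[OF T(1)] ext A(2) by blast
    have nT: "nvol T < real (sum n (X T)) + 1"
      using T(2) K by simp
    obtain i j g where ij: "i < j" "j \<le> sum n (X T)"
      and g: "\<And>v. v \<in> T \<Longrightarrow> g v \<in> \<int> \<and> 0 \<le> g v" "sum g T = real (j - i)"
        "(\<Sum>v\<in>T. g v *\<^sub>R v) = (\<Sum>k=i..<j. s k)"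
      by (rule integral_subsum[where s = s, OF \<T>(3)[OF T(1)] \<T>(4)[OF T(1)] TL sT nT]) (assumption, rule that)
    define cnt where "cnt a = card {k\<in>{i..<j}. s k = a}" for a
    have "s ` {i..<j} \<subseteq> X T"
      using s(1) ij(2) by auto
    from sum_by_values[OF finite_atLeastLessThan X(1) this]
    have vals: "(\<Sum>k=i..<j. s k) = (\<Sum>a\<in>X T. real (cnt a) *\<^sub>R a)" "j - i = sum cnt (X T)"
      by (simp_all only: cnt_def[abs_def] card_atLeastLessThan)
    have cnt_le: "real (cnt a) \<le> m' a" if "a \<in> X T" for a
    proof -
      have "cnt a \<le> card {k. k < sum n (X T) \<and> s k = a}"
        unfolding cnt_def using ij(2) by (intro card_mono) auto
      then have "real (cnt a) \<le> real (n a)"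
        using s(2)[OF that] by simp
      also have "\<dots> = m' a"
        using n X(2) that by blast
      finally show ?thesis .
    qed
    have TA: "T \<subseteq> A" "T \<inter> S = {}"
      using \<T>(2)[OF T(1)] ext by (auto simp: S_def hull_vertices_def)
    have "finite T"
      using TA(1) A(1) finite_subset by blast
    define w where "w a = m' a + (if a \<in> T then g a else 0) - (if a \<in> X T then real (cnt a) else 0)" for a
    have "near_rep A v0 w"
      unfolding near_rep_def
    proof (intro conjI ballI)
      fix a assume "a \<in> A"
      then show "w a \<in> \<int>"
        using m'(1) g(1) by (auto simp: w_def near_rep_def)
    next
      fix a assume "a \<in> A - {v0}"
      then have "0 \<le> m' a"
        using m'(1) by (simp add: near_rep_def)
      then show "0 \<le> w a"
        using g(1) cnt_le TA(2) X(2) by (auto simp: w_def)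
    qed
    moreover have "affine_rel A (\<lambda>v. w v - m' v)"
    proof -
      have w: "w v - m' v = (if v \<in> T then g v else 0) - (if v \<in> X T then real (cnt v) else 0)" for v
        by (simp add: w_def)
      have AT: "A \<inter> T = T" "A \<inter> X T = X T"
        using TA(1) X(2) by (auto simp: S_def)
      have "(\<Sum>v\<in>A. w v - m' v) = sum g T - (\<Sum>v\<in>X T. real (cnt v))"
        unfolding w sum_subtractf using A(1) by (simp add: AT flip: sum.inter_restrict)
      moreover have "(\<Sum>v\<in>A. (w v - m' v) *\<^sub>R v) = (\<Sum>v\<in>T. g v *\<^sub>R v) - (\<Sum>v\<in>X T. real (cnt v) *\<^sub>R v)"
        unfolding w scaleR_diff_left sum_subtractf if_distrib[of "\<lambda>r. r *\<^sub>R _"] scaleR_zero_left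
        using A(1) by (simp add: AT flip: sum.inter_restrict)
      moreover have "(\<Sum>v\<in>X T. real (cnt v)) = real (j - i)"
        using vals(2) by (simp flip: of_nat_sum)
      ultimately show ?thesis
        by (simp add: affine_rel_def g(2,3) vals(1))
    qed
    ultimately have "sum m' S \<le> sum w S"
      by (rule min)
    also have "\<dots> = sum m' S - (\<Sum>a\<in>X T. real (cnt a))"
    proof -
      have "S \<inter> X T = X T"
        using X(2) by blast
      moreover have "w a = m' a - (if a \<in> X T then real (cnt a) else 0)" if "a \<in> S" for a
        using that TA(2) by (auto simp: w_def)
      ultimately show ?thesis
        using S(1) by (simp add: sum_subtractf flip: sum.inter_restrict)
    qed
    also have "(\<Sum>a\<in>X T. real (cnt a)) = real (j - i)"
      using vals(2) by (simp flip: of_nat_sum)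
    finally show False
      using ij(1) by simp
  qed
  then show thesis
    using that[OF m'] \<T>(6) by (simp add: S_def)
qed

subsection \<open>Facet weights\<close>

lemma finite_kappa_set:
  fixes A :: "(real^'n) set"
  assumes "finite A"
  shows "finite {Max (vol_pyramid F ` (A - F)) / Min (vol_pyramid F ` (A - F)) | F.
            F facet_of (convex hull A)}"
proof -
  have "finite {F. F facet_of (convex hull A)}"
    using assms finite_polytope_facets polytope_convex_hull by blast
  then show ?thesis
    by (auto intro: finite_image_set)
qed

text \<open>By \<open>vol_pyramid_ratio\<close>, volumes of pyramids over \<open>F\<close> are
  proportional to the heights \<open>\<beta> - n \<bullet> a\<close> of their apices, so
  \<open>kappa A\<close> bounds quotients of heights; points of \<open>F\<close> have height
  0.\<close>

lemma facet_weight: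
  fixes A :: "(real^'n) set"
  assumes A: "finite A" "affine hull A = UNIV" and F: "F facet_of (convex hull A)" and v: "v \<in> A - F"
  obtains n \<beta> where "F \<subseteq> {x. n \<bullet> x = \<beta>}" "\<And>a. a \<in> A \<Longrightarrow> n \<bullet> a \<le> \<beta>" "n \<bullet> v < \<beta>"
    "\<And>a. a \<in> A \<Longrightarrow> \<beta> - n \<bullet> a \<le> kappa A * (\<beta> - n \<bullet> v)" "1 \<le> kappa A"
proof -
  have poly: "polytope (convex hull A)"
    using A(1) polytope_convex_hull by blast
  obtain n \<beta> where n: "convex hull A \<subseteq> {x. n \<bullet> x \<le> \<beta>}" "F = convex hull A \<inter> {x. n \<bullet> x = \<beta>}"
    using facet_of_polyhedron[OF polytope_imp_polyhedron[OF poly] F] by metis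
  have le: "n \<bullet> a \<le> \<beta>" if "a \<in> A" for a
    using n(1) that hull_inc by fastforce
  have less: "n \<bullet> a < \<beta>" if "a \<in> A - F" for a
    using n(2) le[of a] that hull_inc[of a A convex] by (auto simp: less_le)
  have FH: "F \<subseteq> {x. n \<bullet> x = \<beta>}"
    using n(2) by blast
  have bF: "bounded F"
    using n(2) polytope_imp_bounded[OF poly] by (meson bounded_subset Int_lower1)
  have pos: "0 < vol_pyramid F a" if "a \<in> A - F" for a
  proof -
    have "affine hull F \<subseteq> {x. n \<bullet> x = \<beta>}"
      using FH by (intro hull_minimal affine_hyperplane)
    \<comment> \<open>A point off the hyperplane spans a full-dimensional pyramid with
      \<open>F\<close>, so the denominators in \<open>kappa\<close> are positive.\<close>
    then have "a \<notin> affine hull F"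
      using less[OF that] by auto
    moreover have "aff_dim F = int CARD('n) - 1"
      using F A(2) aff_dim_eq_full[of A] by (simp add: facet_of_def aff_dim_convex_hull)
    ultimately have "aff_dim (insert a F) = int CARD('n)"
      by (simp add: aff_dim_insert)
    then have "affine hull (insert a F) = UNIV"
      using aff_dim_eq_full[of "insert a F"] by simp
    then show ?thesis
      unfolding vol_pyramid_def using bF by (intro measure_convex_hull_pos) auto
  qed
  have ratio: "(\<beta> - n \<bullet> a) / (\<beta> - n \<bullet> v) \<le> kappa A" if a: "a \<in> A - F" for a
  proof -
    have "vol_pyramid F a = (\<beta> - n \<bullet> a) / (\<beta> - n \<bullet> v) * vol_pyramid F v"
      using vol_pyramid_ratio[OF FH bF less[OF v]] le a by simp
    then have "(\<beta> - n \<bullet> a) / (\<beta> - n \<bullet> v) = vol_pyramid F a / vol_pyramid F v"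
      using pos[OF v] by simp
    also have "\<dots> \<le> Max (vol_pyramid F ` (A - F)) / Min (vol_pyramid F ` (A - F))"
    proof (rule frac_le)
      show "vol_pyramid F a \<le> Max (vol_pyramid F ` (A - F))"
        using A(1) a by simp
      show "Min (vol_pyramid F ` (A - F)) \<le> vol_pyramid F v"
        using A(1) v by simp
      show "0 < Min (vol_pyramid F ` (A - F))"
        using A(1) v pos by (subst Min_gr_iff) auto
      show "0 \<le> Max (vol_pyramid F ` (A - F))"
        using A(1) a pos[OF a] by (subst Max_ge_iff) (auto intro!: bexI[of _ a])
    qed
    also have "\<dots> \<le> kappa A"
      unfolding kappa_def using F by (intro Max_ge finite_kappa_set A(1)) blast
    finally show ?thesis .
  qed
  show thesis
  proof (rule that[OF FH le less[OF v]])
    show "1 \<le> kappa A"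
      using ratio[OF v] less[OF v] by simp
    show "\<beta> - n \<bullet> a \<le> kappa A * (\<beta> - n \<bullet> v)" if "a \<in> A" for a
    proof (cases "a \<in> F")
      case True
      then have "\<beta> - n \<bullet> a = 0"
        using FH by auto
      then show ?thesis
        using \<open>1 \<le> kappa A\<close> less[OF v] by simp
    next
      case False
      then show ?thesis
        using ratio[of a] that less[OF v] by (simp add: field_simps)
    qed
  qed
qed

subsection \<open>The structure theorem\<close>

lemma hull_vertices_subset: "hull_vertices A \<subseteq> A"
  using extreme_point_of_convex_hull by (auto simp: hull_vertices_def)

lemma int_lattice_sum: "(\<And>i. i \<in> I \<Longrightarrow> f i \<in> int_lattice) \<Longrightarrow> sum f I \<in> int_lattice"
  by (auto simp: int_lattice_def intro!: Ints_sum)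

text \<open>The easy inclusion: if \<open>x\<close> is the sum of \<open>b i\<close>, then
  \<open>N a - x\<close> is the sum of \<open>a - b i\<close> and hence not exceptional.\<close>

lemma structure_holds_upper:
  fixes A :: "(real^'n) set"
  assumes "A \<subseteq> int_lattice" "1 \<le> N"
  shows "nfold_sum N A \<subseteq> (nfold_sum N (convex hull A) \<inter> int_lattice) -
       (\<Union>a\<in>hull_vertices A. (\<lambda>e. real N *\<^sub>R a - e) ` exceptional ((\<lambda>b. a - b) ` A))"
proof
  fix x assume "x \<in> nfold_sum N A"
  then obtain b where b: "x = (\<Sum>i<N. b i)" "\<And>i. i < N \<Longrightarrow> b i \<in> A"
    by (auto simp: nfold_sum_def)
  have "x \<in> nfold_sum N (convex hull A)"
    using b hull_inc[of _ A convex] by (auto simp: nfold_sum_def)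
  moreover have "x \<in> int_lattice"
    unfolding b(1) using b(2) assms(1) by (intro int_lattice_sum) auto
  moreover have "e \<notin> exceptional ((\<lambda>b. a - b) ` A)" if "x = real N *\<^sub>R a - e" for a e
  proof -
    have "e = (\<Sum>i<N. a - b i)"
      using that b(1) by (simp add: sum_subtractf sum_constant_scaleR del: sum_constant)
    then have "e \<in> nfold_sum N ((\<lambda>b. a - b) ` A)"
      using b(2) by (auto simp: nfold_sum_def)
    then show ?thesis
      using assms(2) by (auto simp: exceptional_def all_sums_def)
  qed
  ultimately show "x \<in> (nfold_sum N (convex hull A) \<inter> int_lattice) -
       (\<Union>a\<in>hull_vertices A. (\<lambda>e. real N *\<^sub>R a - e) ` exceptional ((\<lambda>b. a - b) ` A))"
    by blast
qed

lemma nfold_sumI: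
  fixes A :: "(real^'n) set"
  assumes A: "finite A" and m: "\<And>a. a \<in> A \<Longrightarrow> m a \<in> \<int> \<and> 0 \<le> m a"
    and N: "sum m A = real N" and x: "(\<Sum>a\<in>A. m a *\<^sub>R a) = x"
  shows "x \<in> nfold_sum N A"
proof -
  define n where "n a = nat \<lfloor>m a\<rfloor>" for a
  have n: "real (n a) = m a" if "a \<in> A" for a
    using m[OF that] by (auto simp: n_def elim!: Ints_cases)
  have "real (sum n A) = real N"
    unfolding N[symmetric] using n by (auto intro!: sum.cong)
  then have sum_n: "sum n A = N"
    by (simp only: of_nat_eq_iff)
  obtain s where s: "\<And>k. k < N \<Longrightarrow> s k \<in> A" "\<And>a. a \<in> A \<Longrightarrow> card {k. k < N \<and> s k = a} = n a"
    using seq_with_multiplicities[OF A, of n] unfolding sum_n by blast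
  have "s ` {..<N} \<subseteq> A"
    using s(1) by auto
  from sum_by_values(1)[OF finite_lessThan A this]
  have "(\<Sum>k<N. s k) = (\<Sum>a\<in>A. real (n a) *\<^sub>R a)"
    using s(2) by simp
  also have "\<dots> = x"
    unfolding x[symmetric] using n by (intro sum.cong) auto
  finally show ?thesis
    using s(1) unfolding nfold_sum_def by blast
qed

text \<open>Solving for \<open>x\<close> gives the sum of \<open>M\<close> points of
  \<open>A\<close> plus \<open>(N - M) v0\<close>; for \<open>M > N\<close> the coefficient of
  \<open>v0\<close> may be negative.\<close>

lemma near_rep_of_difference_sum:
  fixes A :: "(real^'n) set"
  assumes A: "finite A" "v0 \<in> A" and x: "real N *\<^sub>R v0 - x \<in> nfold_sum M ((\<lambda>b. v0 - b) ` A)"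
  obtains m where "near_rep A v0 m" "sum m A = real N" "(\<Sum>a\<in>A. m a *\<^sub>R a) = x"
proof -
  obtain y where y: "real N *\<^sub>R v0 - x = (\<Sum>i<M. y i)" "\<forall>i<M. y i \<in> (\<lambda>b. v0 - b) ` A"
    using x unfolding nfold_sum_def by blast
  then have "\<exists>b\<in>A. y i = v0 - b" if "i < M" for i
    using that by blast
  then obtain b where b: "\<And>i. i < M \<Longrightarrow> b i \<in> A" "\<And>i. i < M \<Longrightarrow> y i = v0 - b i"
    by metis
  have "(\<Sum>i<M. y i) = (\<Sum>i<M. v0 - b i)"
    using b(2) by simp
  then have xb: "x = (\<Sum>i<M. b i) + (real N - real M) *\<^sub>R v0"
    using y(1) by (simp add: sum_subtractf sum_constant_scaleR algebra_simps del: sum_constant)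
  define n where "n a = card {i\<in>{..<M}. b i = a}" for a
  define m where "m a = real (n a) + (if a = v0 then real N - real M else 0)" for a
  have "b ` {..<M} \<subseteq> A"
    using b(1) by auto
  from sum_by_values[OF finite_lessThan A(1) this]
  have nb: "(\<Sum>i<M. b i) = (\<Sum>a\<in>A. real (n a) *\<^sub>R a)" "M = sum n A"
    by (simp_all only: n_def[abs_def] card_lessThan)
  have "near_rep A v0 m"
    by (auto simp: near_rep_def m_def)
  moreover have "sum m A = real N"
    using A nb(2) by (simp add: m_def sum.distrib)
  moreover have "(\<Sum>a\<in>A. m a *\<^sub>R a) = x"
  proof -
    have "(\<Sum>a\<in>A. m a *\<^sub>R a) =
        (\<Sum>a\<in>A. real (n a) *\<^sub>R a + (if a = v0 then (real N - real M) *\<^sub>R v0 else 0))"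
      by (intro sum.cong) (auto simp: m_def scaleR_add_left)
    then show ?thesis
      using A by (simp add: sum.distrib xb nb(1))
  qed
  ultimately show thesis
    using that by blast
qed

text \<open>Total height thus depends only on the coefficient sum and the represented point, and it
  vanishes on affine relations.\<close>

lemma sum_affine_weight:
  fixes n :: "'a::real_inner"
  shows "(\<Sum>v\<in>S. u v * (\<beta> - n \<bullet> v)) = \<beta> * sum u S - n \<bullet> (\<Sum>v\<in>S. u v *\<^sub>R v)"
  by (simp add: right_diff_distrib sum_subtractf inner_sum_right sum_distrib_left mult.commute)

lemma affine_hull_hull_vertices:
  fixes A :: "(real^'n) set"
  assumes "finite A"
  shows "affine hull (hull_vertices A) = affine hull A"
  using Krein_Milman_polytope[OF assms] unfolding hull_vertices_def
  by (metis affine_hull_convex_hull)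

text \<open>Caratheodory with vertices only, read off from a pulling triangulation. Zero
  coefficients are allowed, so the number of vertices is exactly the dimension plus 1.\<close>

lemma polytope_barycentric:
  fixes Q :: "'a::euclidean_space set"
  assumes "polytope Q" "q \<in> Q"
  obtains T c where "T \<subseteq> {v. v extreme_point_of Q}" "\<not> affine_dependent T" "finite T"
    "int (card T) = aff_dim Q + 1" "\<And>v. v \<in> T \<Longrightarrow> 0 \<le> c v" "sum c T = 1" "(\<Sum>v\<in>T. c v *\<^sub>R v) = q"
proof -
  obtain T where T: "T \<subseteq> {v. v extreme_point_of Q}" "\<not> affine_dependent T" "aff_dim T = aff_dim Q"
    "q \<in> convex hull T"
    using pulling_triangulation[OF assms(1)] assms(2) by blast
  then have fin: "finite T" "int (card T) = aff_dim Q + 1"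
    using affine_independent_iff_card[of T] by auto
  obtain c where "\<forall>v\<in>T. 0 \<le> c v" "sum c T = 1" "(\<Sum>v\<in>T. c v *\<^sub>R v) = q"
    using T(4) unfolding convex_hull_finite[OF fin(1)] by blast
  then show thesis
    using that T fin by blast
qed

text \<open>The weight \<open>\<beta> - n \<bullet> v\<close> of a facet vanishes on the facet, so comparing the weights of the two
  representations bounds the coefficient of \<open>v0\<close> from below.\<close>

lemma near_rep_improve:
  fixes A :: "(real^'n) set"
  assumes A: "finite A" "A \<subseteq> int_lattice" "affine hull A = UNIV"
    and V: "hull_vertices A \<subseteq> V" "V \<subseteq> A" and v0: "v0 \<in> hull_vertices A"
    and m: "near_rep A v0 m" "sum m A = N" "sum m (A - V) \<le> R"
    and q: "\<And>v. v \<in> T \<Longrightarrow> 0 \<le> c v" "sum c T = 1" "T \<subseteq> A" "v0 \<in> T" "\<delta> \<le> c v0"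
      "(\<Sum>a\<in>A. m a *\<^sub>R a) = N *\<^sub>R (\<Sum>v\<in>T. c v *\<^sub>R v)"
    and N: "0 \<le> N" "R - 1 < N"
      "kappa A * R + vol_dagger_max A * (real (card V) - real CARD('n) - 1) - 1 < N * \<delta>"
  obtains m' where "near_rep A v0 m'" "affine_rel A (\<lambda>v. m' v - m v)" "-1 < m' v0"
proof -
  let ?W = "vol_dagger_max A"
  have v0A: "v0 \<in> A" "v0 \<in> V"
    using v0 V by auto
  have fin: "finite V" "finite T"
    using A(1) V(2) q(3) finite_subset by blast+
  define P where "P = V - {v0}"
  define K where "K = sum m P"
  define r where "r = sum m (A - V)"
  have mP: "0 \<le> m v" if "v \<in> P" for v
    using m(1) V(2) that by (auto simp: near_rep_def P_def)
  have mR: "0 \<le> m v" if "v \<in> A - V" for v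
    using m(1) v0A(2) that by (auto simp: near_rep_def)
  have "0 \<le> K" "0 \<le> r"
    using mP mR by (auto simp: K_def r_def intro!: sum_nonneg)
  have sumV: "sum m V = m v0 + K"
    using fin(1) v0A(2) by (simp add: K_def P_def sum.remove)
  have sumA: "N = sum m V + r"
    using A(1) V(2) by (simp add: r_def flip: m(2)) (metis sum.subset_diff add.commute)
  show thesis
  \<comment> \<open>Without other points of \<open>V\<close> there is no ray to follow, but then
    \<open>v0\<close> already carries everything except the remainder \<open>r\<close>.\<close>
  proof (cases "K = 0")
    case True
    then have "m v0 = N - r"
      using sumV sumA by simp
    then have "-1 < m v0"
      using N(2) m(3) by (simp add: r_def)
    then show thesis
      using that[OF m(1)] by (simp add: affine_rel_def)
  next
    case False
    then have "0 < K"
      using \<open>0 \<le> K\<close> by simp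
    define p where "p = (1 / K) *\<^sub>R (\<Sum>v\<in>P. m v *\<^sub>R v)"
    have "finite P"
      using fin(1) by (simp add: P_def)
    have "p = (\<Sum>v\<in>P. (m v / K) *\<^sub>R v)"
      by (simp add: p_def scaleR_sum_right)
    moreover have "(\<Sum>v\<in>P. m v / K) = 1"
      using False by (simp add: K_def flip: sum_divide_distrib)
    moreover have "\<forall>v\<in>P. 0 \<le> m v / K"
      using mP \<open>0 < K\<close> by simp
    ultimately have "p \<in> convex hull P"
      unfolding convex_hull_finite[OF \<open>finite P\<close>] by (intro CollectI exI[of _ "\<lambda>v. m v / K"]) simp
    \<comment> \<open>Here \<open>v0\<close> must be extreme: deleting it from the hull leaves a
      convex set, so the mean \<open>p\<close> of the other points differs from
      \<open>v0\<close>.\<close>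
    moreover have "convex hull P \<subseteq> convex hull A - {v0}"
    proof (rule hull_minimal)
      show "P \<subseteq> convex hull A - {v0}"
        using V(2) hull_inc[of _ A convex] by (auto simp: P_def)
      show "convex (convex hull A - {v0})"
        using v0 extreme_point_of_stillconvex[of "convex hull A" v0] by (simp add: hull_vertices_def)
    qed
    ultimately have p: "p \<in> convex hull A" "p \<noteq> v0"
      by auto
    have poly: "polytope (convex hull A)"
      using A(1) polytope_convex_hull by blast
    have "v0 \<in> convex hull A"
      using v0A(1) by (rule hull_inc)
    then obtain F f t where F: "F facet_of (convex hull A)" "v0 \<notin> F" "f \<in> F" and t: "0 < t" "t \<le> 1"
      and pf: "p = (1 - t) *\<^sub>R v0 + t *\<^sub>R f"
      using exit_facet[OF poly _ p] by blast
    have Fface: "F face_of (convex hull A)"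
      using F(1) by (simp add: facet_of_def)
    obtain B \<gamma> where B: "B \<subseteq> {v. v extreme_point_of F}" "\<not> affine_dependent B" "finite B"
        "int (card B) = aff_dim F + 1"
      and \<gamma>: "\<And>v. v \<in> B \<Longrightarrow> 0 \<le> \<gamma> v" "sum \<gamma> B = 1" "(\<Sum>v\<in>B. \<gamma> v *\<^sub>R v) = f"
      by (rule polytope_barycentric[OF face_of_polytope_polytope[OF poly Fface] F(3)]) (rule that)
    have BF: "B \<subseteq> F"
      using B(1) by (auto simp: extreme_point_of_def)
    have BV: "B \<subseteq> V"
      using B(1) V(1) extreme_point_of_face[OF Fface] by (auto simp: hull_vertices_def)
    have "v0 \<notin> B"
      using BF F(2) by blast
    have "v0 \<in> A - F"
      using F(2) v0A(1) by blast
    then obtain n \<beta> where n: "F \<subseteq> {x. n \<bullet> x = \<beta>}" "\<And>a. a \<in> A \<Longrightarrow> n \<bullet> a \<le> \<beta>" "n \<bullet> v0 < \<beta>"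
      "\<And>a. a \<in> A \<Longrightarrow> \<beta> - n \<bullet> a \<le> kappa A * (\<beta> - n \<bullet> v0)" "1 \<le> kappa A"
      using facet_weight[OF A(1,3) F(1)] by blast
    have "affine hull B \<subseteq> {x. n \<bullet> x = \<beta>}"
      using BF n(1) by (intro hull_minimal affine_hyperplane) blast
    then have indep: "\<not> affine_dependent (insert v0 B)"
      using n(3) by (intro affine_independent_insert[OF B(2)]) auto
    \<comment> \<open>The real representation of the \<open>V\<close>-part on the pyramid: the mass
      \<open>K\<close> at \<open>p\<close> is split between the apex, with share
      \<open>1 - t\<close>, and the exit point \<open>f\<close>, expanded in vertices
      \<open>B\<close> of the facet.\<close>
    define d where "d v = (if v = v0 then m v0 + K * (1 - t) else if v \<in> B then K * t * \<gamma> v else 0)" for v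
    have sum_d: "(\<Sum>v\<in>V. d v *\<^sub>R h v) = (m v0 + K * (1 - t)) *\<^sub>R h v0 + (K * t) *\<^sub>R (\<Sum>v\<in>B. \<gamma> v *\<^sub>R h v)"
      for h :: "real^'n \<Rightarrow> 'b::real_vector"
    proof -
      have "(\<Sum>v\<in>V. d v *\<^sub>R h v) = (\<Sum>v\<in>insert v0 B. d v *\<^sub>R h v)"
        using fin(1) BV v0A(2) by (intro sum.mono_neutral_right) (auto simp: d_def)
      also have "\<dots> = (m v0 + K * (1 - t)) *\<^sub>R h v0 + (\<Sum>v\<in>B. d v *\<^sub>R h v)"
        using B(3) \<open>v0 \<notin> B\<close> by (simp add: d_def)
      also have "(\<Sum>v\<in>B. d v *\<^sub>R h v) = (K * t) *\<^sub>R (\<Sum>v\<in>B. \<gamma> v *\<^sub>R h v)"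
        using \<open>v0 \<notin> B\<close> unfolding scaleR_sum_right by (intro sum.cong) (auto simp: d_def)
      finally show ?thesis .
    qed
    have "affine_rel V (\<lambda>v. m v - d v)"
    proof -
      have "sum d V = m v0 + K"
        using sum_d[of "\<lambda>_. 1 :: real"] \<gamma>(2) by (simp add: algebra_simps)
      moreover have "(\<Sum>v\<in>V. m v *\<^sub>R v) = m v0 *\<^sub>R v0 + K *\<^sub>R p"
        using fin(1) v0A(2) False by (simp add: p_def P_def sum.remove)
      moreover have "(\<Sum>v\<in>V. d v *\<^sub>R v) = m v0 *\<^sub>R v0 + K *\<^sub>R p"
        unfolding sum_d[of "\<lambda>v. v"] \<gamma>(3) pf by (simp add: algebra_simps)
      ultimately show ?thesis
        by (simp add: affine_rel_def sum_subtractf scaleR_diff_left sumV)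
    qed
    note rel = this
    have mV: "near_rep V v0 m"
      using m(1) V(2) by (auto simp: near_rep_def)
    have W: "nvol J \<le> ?W" if "J \<subseteq> V" "card J = CARD('n) + 1" for J :: "(real^'n) set"
      using nvol_le_vol_dagger_max[OF A(1)] that V(2) by blast
    have affV: "affine hull V = UNIV"
      using affine_hull_hull_vertices[OF A(1)] A(3) V(1) hull_mono[of "hull_vertices A" V affine] by auto
    then obtain J where "\<not> affine_dependent J" "J \<subseteq> V" "affine hull J = UNIV"
      using affine_basis_exists by metis
    then have "0 \<le> ?W"
      using W card_simplex nvol_nonneg order_trans by metis
    have d_nonneg: "0 \<le> d v" if "v \<in> V - {v0}" for v
      using \<gamma>(1) t \<open>0 < K\<close> that by (simp add: d_def)
    have d_zero: "d v = 0" if "v \<in> V - insert v0 B" for v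
      using that by (simp add: d_def)
    have VL: "V \<subseteq> int_lattice"
      using V(2) A(2) by blast
    obtain mV' where mV': "near_rep V v0 mV'" "affine_rel V (\<lambda>v. mV' v - m v)"
      "d v0 - ?W * (real (card V) - real CARD('n) - 1) \<le> mV' v0"
      by (rule near_rep_proximity[OF fin(1) VL affV W \<open>0 \<le> ?W\<close> v0A(2) BV indep mV d_nonneg d_zero rel])
    define m' where "m' v = (if v \<in> V then mV' v else m v)" for v
    have "near_rep A v0 m'"
      using m(1) mV'(1) by (auto simp: near_rep_def m'_def)
    moreover have "affine_rel A (\<lambda>v. m' v - m v)"
    proof -
      have "affine_rel V (\<lambda>v. m' v - m v)"
        using mV'(2) by (simp add: affine_rel_def m'_def cong: sum.cong)
      then show ?thesis
        by (subst affine_rel_mono_neutral[OF A(1) V(2)]) (auto simp: m'_def)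
    qed
    moreover have "-1 < m' v0"
    proof -
      define h where "h v = \<beta> - n \<bullet> v" for v
      have h: "0 \<le> h a" if "a \<in> A" for a
        using n(2)[OF that] by (simp add: h_def)
      have "0 < h v0"
        using n(3) by (simp add: h_def)
      \<comment> \<open>Total height of \<open>x\<close>, computed in two ways: at least the
        contribution of \<open>v0\<close> to the representation on \<open>T\<close>, and at most
        that of the apex plus \<open>kappa A * R\<close> heights of \<open>v0\<close>.\<close>
      have "N * (\<delta> * h v0) \<le> N * (c v0 * h v0)"
        using N(1) q(5) \<open>0 < h v0\<close> by (simp add: mult_left_mono mult_right_mono)
      also have "\<dots> \<le> N * (\<Sum>v\<in>T. c v * h v)"
        using q(1,3,4) h fin(2) N(1)
        by (intro mult_left_mono member_le_sum[of v0 T "\<lambda>v. c v * h v"]) auto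
      also have "\<dots> = (\<Sum>a\<in>A. m a * h a)"
        unfolding h_def sum_affine_weight q(2,6) m(2) by (simp add: algebra_simps)
      also have "\<dots> = (\<Sum>v\<in>V. m v * h v) + (\<Sum>v\<in>A - V. m v * h v)"
        using sum.subset_diff[OF V(2) A(1)] by (simp add: add.commute)
      also have "(\<Sum>v\<in>V. m v * h v) = (\<Sum>v\<in>V. d v * h v)"
      proof -
        have "(\<Sum>v\<in>V. (m v - d v) * h v) = 0"
          using rel unfolding h_def sum_affine_weight affine_rel_def by simp
        then show ?thesis
          by (simp add: left_diff_distrib sum_subtractf)
      qed
      also have "\<dots> = d v0 * h v0"
      proof -
        have "(\<Sum>v\<in>B. \<gamma> v * h v) = 0"
          using BF n(1) by (intro sum.neutral) (auto simp: h_def)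
        then show ?thesis
          using sum_d[of h] by (simp add: d_def)
      qed
      also have "(\<Sum>v\<in>A - V. m v * h v) \<le> (\<Sum>v\<in>A - V. m v * (kappa A * h v0))"
        using mR n(4) by (intro sum_mono mult_left_mono) (auto simp: h_def)
      also have "\<dots> = r * (kappa A * h v0)"
        by (simp add: r_def sum_distrib_right)
      also have "\<dots> \<le> R * (kappa A * h v0)"
        using m(3) n(5) \<open>0 < h v0\<close> by (intro mult_right_mono) (auto simp: r_def)
      finally have "(N * \<delta>) * h v0 \<le> (d v0 + kappa A * R) * h v0"
        by (simp add: algebra_simps)
      then have "N * \<delta> \<le> d v0 + kappa A * R"
        using \<open>0 < h v0\<close> by simp
      then show ?thesis
        using N(3) mV'(3) v0A(2) by (simp add: m'_def)
    qed
    ultimately show thesis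
      using that by blast
  qed
qed

lemma kappa_ge_1:
  fixes A :: "(real^'n) set"
  assumes A: "finite A" "affine hull A = UNIV"
  shows "1 \<le> kappa A"
proof -
  have "A \<noteq> {}"
    using A(2) by auto
  moreover have "A \<noteq> {v}" for v
  proof
    assume "A = {v}"
    then have "aff_dim A = 0" by simp
    then show False
      using A(2) aff_dim_eq_full[of A] by simp
  qed
  ultimately obtain v p where vp: "v \<in> A" "p \<in> A" "p \<noteq> v"
    by blast
  have "polytope (convex hull A)"
    using A(1) polytope_convex_hull by blast
  then obtain F where "F facet_of (convex hull A)" "v \<notin> F"
    using exit_facet[of "convex hull A" v p] vp hull_inc[of _ A convex] by metis
  then show ?thesis
    using facet_weight[OF A, of F v] vp(1) by blast
qed

text \<open>The common core of both bounds, used with \<open>V = hull_vertices A\<close> and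
  \<open>R\<close> the normalized volume of the hull, and with \<open>V = A\<close> and
  \<open>R = 0\<close>.\<close>

proposition structure_holds_large:
  fixes A :: "(real^'n) set"
  assumes A: "finite A" "A \<subseteq> int_lattice" "affine hull A = UNIV"
    and V: "hull_vertices A \<subseteq> V" "V \<subseteq> A"
    and reduce: "\<And>v0 m. v0 \<in> hull_vertices A \<Longrightarrow> near_rep A v0 m \<Longrightarrow>
      \<exists>m'. near_rep A v0 m' \<and> affine_rel A (\<lambda>v. m' v - m v) \<and> sum m' (A - V) \<le> R"
    and "0 \<le> R" and k: "0 \<le> vol_dagger_max A * (real (card V) - real CARD('n) - 1)"
    and N: "1 \<le> N" "(real CARD('n) + 1) * (kappa A * R +
      vol_dagger_max A * (real (card V) - real CARD('n) - 1)) - 1 < real N"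
  shows "structure_holds A N"
  unfolding structure_holds_def
proof (rule antisym)
  show "nfold_sum N A \<subseteq> (nfold_sum N (convex hull A) \<inter> int_lattice) -
       (\<Union>a\<in>hull_vertices A. (\<lambda>e. real N *\<^sub>R a - e) ` exceptional ((\<lambda>b. a - b) ` A))"
    using structure_holds_upper[OF A(2) N(1)] .
  show "(nfold_sum N (convex hull A) \<inter> int_lattice) -
       (\<Union>a\<in>hull_vertices A. (\<lambda>e. real N *\<^sub>R a - e) ` exceptional ((\<lambda>b. a - b) ` A))
      \<subseteq> nfold_sum N A"
  proof
    fix x assume x: "x \<in> (nfold_sum N (convex hull A) \<inter> int_lattice) -
       (\<Union>a\<in>hull_vertices A. (\<lambda>e. real N *\<^sub>R a - e) ` exceptional ((\<lambda>b. a - b) ` A))"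
    then have "x \<in> (*\<^sub>R) (real N) ` (convex hull A)"
      using nfold_sum_convex[OF convex_convex_hull, of N A] N(1) by auto
    then obtain q where q: "q \<in> convex hull A" "x = real N *\<^sub>R q"
      by blast
    have poly: "polytope (convex hull A)"
      using A(1) polytope_convex_hull by blast
    obtain T c where T: "T \<subseteq> hull_vertices A" "\<not> affine_dependent T" "finite T"
        "int (card T) = aff_dim (convex hull A) + 1"
      and c: "\<And>v. v \<in> T \<Longrightarrow> 0 \<le> c v" "sum c T = 1" "(\<Sum>v\<in>T. c v *\<^sub>R v) = q"
      by (rule polytope_barycentric[OF poly q(1), folded hull_vertices_def]) (rule that)
    have cT: "real (card T) = real CARD('n) + 1"
      using T(4) A(3) aff_dim_eq_full[of A] by (simp add: aff_dim_convex_hull)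
    have TA: "T \<subseteq> A"
      using T(1) V by blast
    have "\<exists>v0\<in>T. 1 / (real CARD('n) + 1) \<le> c v0"
    proof (rule ccontr)
      assume "\<not> ?thesis"
      then have "sum c T < (\<Sum>v\<in>T. 1 / (real CARD('n) + 1))"
        using T(3) cT by (intro sum_strict_mono) (auto simp: not_le)
      then show False
        using c(2) cT by simp
    qed
    then obtain v0 where v0: "v0 \<in> T" "1 / (real CARD('n) + 1) \<le> c v0"
      by blast
    then have v0A: "v0 \<in> hull_vertices A" "v0 \<in> A"
      using T(1) TA by auto
    define e where "e = real N *\<^sub>R v0 - x"
    have "e \<in> gen_cone ((\<lambda>b. v0 - b) ` A)"
    proof -
      \<comment> \<open>With \<open>x = N q\<close>, the point \<open>e\<close> is the combination
        of the \<open>v0 - b\<close> with coefficients \<open>N c b\<close>; \<open>c'\<close>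
        reindexes these by the differences. So \<open>e\<close> is in the cone, and not being
        exceptional places it in \<open>all_sums\<close>.\<close>
      define c' where "c' y = (if v0 - y \<in> T then real N * c (v0 - y) else 0)" for y
      have "(\<Sum>y\<in>(\<lambda>b. v0 - b) ` A. c' y *\<^sub>R y) = (\<Sum>b\<in>A. c' (v0 - b) *\<^sub>R (v0 - b))"
        by (subst sum.reindex) (auto simp: inj_on_def)
      also have "\<dots> = (\<Sum>b\<in>T. c' (v0 - b) *\<^sub>R (v0 - b))"
        using A(1) TA by (intro sum.mono_neutral_right) (auto simp: c'_def)
      also have "\<dots> = (\<Sum>b\<in>T. real N *\<^sub>R (c b *\<^sub>R v0 - c b *\<^sub>R b))"
        by (intro sum.cong) (auto simp: c'_def scaleR_diff_right)
      also have "\<dots> = real N *\<^sub>R (sum c T *\<^sub>R v0 - (\<Sum>b\<in>T. c b *\<^sub>R b))"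
        unfolding scaleR_sum_right[symmetric] sum_subtractf scaleR_sum_left[symmetric] ..
      also have "\<dots> = e"
        by (simp add: c(2,3) e_def q(2) scaleR_diff_right)
      finally show ?thesis
        using c(1) unfolding gen_cone_def
        by (intro CollectI exI[of _ c']) (auto simp: c'_def)
    qed
    moreover have "e \<in> int_lattice"
      using x A(2) v0A(2) by (auto simp: e_def int_lattice_def)
    moreover have "e \<notin> exceptional ((\<lambda>b. v0 - b) ` A)"
    proof
      assume "e \<in> exceptional ((\<lambda>b. v0 - b) ` A)"
      moreover have "x = real N *\<^sub>R v0 - e"
        by (simp add: e_def)
      ultimately show False
        using x v0A(1) by blast
    qed
    ultimately have "e \<in> all_sums ((\<lambda>b. v0 - b) ` A)"
      by (auto simp: exceptional_def)
    then obtain M where "e \<in> nfold_sum M ((\<lambda>b. v0 - b) ` A)"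
      by (auto simp: all_sums_def)
    then obtain m0 where m0: "near_rep A v0 m0" "sum m0 A = real N" "(\<Sum>a\<in>A. m0 a *\<^sub>R a) = x"
      using near_rep_of_difference_sum[OF A(1) v0A(2)] unfolding e_def by blast
    have transfer: "sum w A = sum u A" "(\<Sum>a\<in>A. w a *\<^sub>R a) = (\<Sum>a\<in>A. u a *\<^sub>R a)"
      if "affine_rel A (\<lambda>v. w v - u v)" for w u
      using that by (simp_all add: affine_rel_def sum_subtractf scaleR_diff_left)
    obtain m where m: "near_rep A v0 m" "affine_rel A (\<lambda>v. m v - m0 v)" "sum m (A - V) \<le> R"
      using reduce[OF v0A(1) m0(1)] by blast
    note m_sums = transfer[OF m(2), unfolded m0(2,3)]
    have \<kappa>: "1 \<le> kappa A"
      using kappa_ge_1[OF A(1,3)] .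
    define b where "b = kappa A * R + vol_dagger_max A * (real (card V) - real CARD('n) - 1)"
    have Rb: "R \<le> b"
      using mult_right_mono[OF \<kappa> \<open>0 \<le> R\<close>] k by (simp add: b_def)
    have "b \<le> (real CARD('n) + 1) * b"
      using Rb \<open>0 \<le> R\<close> by (simp add: mult_le_cancel_right1)
    then have N1: "R - 1 < real N"
      using Rb N(2) by (simp add: b_def)
    \<comment> \<open>The -1 inside the product costs \<open>d + 1\<close>, of which the threshold
      has to provide only 1.\<close>
    have "(real CARD('n) + 1) * (b - 1) < real N"
      using N(2) unfolding b_def[symmetric] by (simp add: algebra_simps)
    then have N2: "b - 1 < real N * (1 / (real CARD('n) + 1))"
      by (simp add: field_simps)
    have combo: "(\<Sum>a\<in>A. m a *\<^sub>R a) = real N *\<^sub>R (\<Sum>v\<in>T. c v *\<^sub>R v)"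
      by (simp add: m_sums c(3) q(2))
    obtain m' where m': "near_rep A v0 m'" "affine_rel A (\<lambda>v. m' v - m v)" "-1 < m' v0"
      by (rule near_rep_improve[OF A V v0A(1) m(1) m_sums(1) m(3) c(1,2) TA v0 combo _ N1 N2[unfolded b_def]]) auto
    show "x \<in> nfold_sum N A"
    proof (rule nfold_sumI[OF A(1)])
      show "sum m' A = real N" "(\<Sum>a\<in>A. m' a *\<^sub>R a) = x"
        using transfer[OF m'(2)] m_sums by auto
      fix a assume a: "a \<in> A"
      have "0 \<le> m' v0"
        using m'(1,3) v0A(2) by (auto simp: near_rep_def elim!: Ints_cases)
      then show "m' a \<in> \<int> \<and> 0 \<le> m' a"
        using m'(1) a by (auto simp: near_rep_def)
    qed
  qed
qed

text \<open>Every integer \<open>N\<close> from the floor of \<open>b\<close> on exceeds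
  \<open>b - 1\<close>, so the floor is an admissible \<open>N0\<close>.\<close>

lemma structure_from_bound:
  assumes b: "1 \<le> b" and N: "\<And>N. 1 \<le> N \<Longrightarrow> b - 1 < real N \<Longrightarrow> structure_holds A N"
  shows "\<exists>N0. structure_from A N0" "real (N_Str A) \<le> b"
proof -
  have "structure_from A (nat \<lfloor>b\<rfloor>)"
    unfolding structure_from_def
  proof (intro conjI allI impI N)
    have "1 \<le> \<lfloor>b\<rfloor>"
      using b by simp
    then show "0 < nat \<lfloor>b\<rfloor>"
      by simp
    fix N assume "nat \<lfloor>b\<rfloor> \<le> N"
    then have "\<lfloor>b\<rfloor> \<le> int N"
      by linarith
    then show "1 \<le> N" "b - 1 < real N"
      using \<open>1 \<le> \<lfloor>b\<rfloor>\<close> by linarith+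
  qed
  then show "\<exists>N0. structure_from A N0"
    by blast
  have "N_Str A \<le> nat \<lfloor>b\<rfloor>"
    unfolding N_Str_def by (rule Least_le) fact
  then show "real (N_Str A) \<le> b"
    using b by linarith
qed

lemma affine_hull_UNIV_of_gen_lattice:
  fixes A :: "(real^'n) set"
  assumes "0 \<in> A" "gen_lattice A = int_lattice"
  shows "affine hull A = UNIV"
proof -
  have "Basis \<subseteq> (int_lattice :: (real^'n) set)"
    by (auto simp: int_lattice_def Basis_vec_def axis_def)
  also have "\<dots> \<subseteq> span A"
    unfolding assms(2)[symmetric] gen_lattice_def
    by (auto intro!: span_sum span_scale intro: span_base)
  finally have "span A = UNIV"
    by (metis span_Basis span_minimal subspace_span top.extremum_uniqueI)
  then show ?thesis
    using affine_hull_span_0[of A] assms(1) by (simp add: hull_inc)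
qed

theorem mainTheorem2:
  fixes A :: "(real^'n) set"
  assumes "finite A"
    and "A \<subseteq> int_lattice"
    and "0 \<in> hull_vertices A"
    and "gen_lattice A = int_lattice"
  shows "(\<exists>N0. structure_from A N0) \<and>
    real (N_Str A) \<le> (real CARD('n) + 1) * kappa A *
      (fact CARD('n) * measure lebesgue (convex hull A) +
        (real (card (hull_vertices A)) - real CARD('n) - 1) * vol_dagger_max A) \<and>
    (card A \<noteq> CARD('n) + 1 \<longrightarrow>
      real (N_Str A) \<le> (real CARD('n) + 1) * kappa A *
        (real (card A) - real CARD('n) - 1) * vol_dagger_max A) \<and>
    (card A = CARD('n) + 1 \<longrightarrow> N_Str A = 1)"
proof -
  let ?d = "real CARD('n)" and ?W = "vol_dagger_max A" and ?E = "hull_vertices A"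
  let ?vol = "fact CARD('n) * measure lebesgue (convex hull A)"
  have "0 \<in> A"
    using assms(3) hull_vertices_subset by blast
  then have A: "finite A" "A \<subseteq> int_lattice" "affine hull A = UNIV"
    using assms affine_hull_UNIV_of_gen_lattice by auto
  have \<kappa>: "1 \<le> kappa A"
    using kappa_ge_1[OF A(1,3)] .
  \<comment> \<open>A lattice simplex on vertices of the hull has normalized volume a positive
    integer. It shows that \<open>vol_dagger_max A\<close> and \<open>?vol\<close> are at least 1
    and that there are at least \<open>d + 1\<close> vertices.\<close>
  obtain J where J: "\<not> affine_dependent J" "J \<subseteq> ?E" "affine hull J = affine hull ?E"
    using affine_basis_exists by metis
  then have J: "J \<subseteq> ?E" "card J = CARD('n) + 1" "0 < nvol J"
    using card_simplex[of J] nvol_pos[of J] affine_hull_hull_vertices[OF A(1)] A(3) by auto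
  have JA: "J \<subseteq> A"
    using J(1) hull_vertices_subset by blast
  have "nvol J \<in> \<int>"
    using nvol_Ints[OF _ J(2)] JA A(2) by blast
  then have "1 \<le> nvol J"
    using J(3) by (auto elim!: Ints_cases)
  then have W: "1 \<le> ?W"
    using nvol_le_vol_dagger_max[OF A(1) JA J(2)] by simp
  have hull_meas: "convex hull S \<in> lmeasurable" if "finite S" for S :: "(real^'n) set"
    using that by (simp add: measurable_convex bounded_convex_hull finite_imp_bounded)
  have "nvol J \<le> ?vol"
    unfolding nvol_def using JA A(1)
    by (intro mult_left_mono measure_mono_fmeasurable hull_mono fmeasurableD hull_meas)
      (auto intro: finite_subset)
  then have vol: "1 \<le> ?vol"
    using \<open>1 \<le> nvol J\<close> by simp
  have finE: "finite ?E"
    using A(1) hull_vertices_subset finite_subset by blast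
  have cardE: "CARD('n) + 1 \<le> card ?E"
    using card_mono[OF finE J(1)] J(2) by simp
  have cardA: "CARD('n) + 1 \<le> card A"
    using card_mono[OF A(1) JA] J(2) by simp
  \<comment> \<open>With \<open>V = A\<close> nothing lies outside \<open>V\<close>, so
    \<open>m\<close> itself meets the reduction hypothesis with \<open>R = 0\<close>.\<close>
  have holdsA: "structure_holds A N" if "1 \<le> N" "(?d + 1) * (?W * (real (card A) - ?d - 1)) - 1 < real N" for N
  proof (rule structure_holds_large[OF A hull_vertices_subset subset_refl, of 0])
    show "\<exists>m'. near_rep A v0 m' \<and> affine_rel A (\<lambda>v. m' v - m v) \<and> sum m' (A - A) \<le> 0"
      if "near_rep A v0 m" for v0 m
      using that by (intro exI[of _ m]) (simp add: affine_rel_def)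
    show "0 \<le> ?W * (real (card A) - ?d - 1)"
      using W cardA by simp
  qed (use that in auto)
  define b1 where "b1 = (?d + 1) * kappa A * (?vol + (real (card ?E) - ?d - 1) * ?W)"
  have kE: "0 \<le> ?W * (real (card ?E) - ?d - 1)"
    using W cardE by simp
  have one: "1 \<le> (?d + 1) * kappa A"
    using mult_mono[of 1 "?d + 1" 1 "kappa A"] \<kappa> by simp
  have "structure_holds A N" if "1 \<le> N" "b1 - 1 < real N" for N
  proof (rule structure_holds_large[OF A subset_refl hull_vertices_subset, of ?vol])
    show "\<exists>m'. near_rep A v0 m' \<and> affine_rel A (\<lambda>v. m' v - m v) \<and> sum m' (A - ?E) \<le> ?vol"
      if "v0 \<in> ?E" "near_rep A v0 m" for v0 m
      using near_rep_vertices[OF A that] by blast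
    \<comment> \<open>\<open>1 \<le> kappa A\<close> allows \<open>kappa A\<close> to be factored
      out of both summands.\<close>
    have "(?d + 1) * (kappa A * ?vol + ?W * (real (card ?E) - ?d - 1)) \<le>
        (?d + 1) * (kappa A * ?vol + kappa A * (?W * (real (card ?E) - ?d - 1)))"
      using mult_right_mono[OF \<kappa> kE] by (intro mult_left_mono add_left_mono) auto
    also have "\<dots> = b1"
      by (simp add: b1_def algebra_simps)
    finally show "(?d + 1) * (kappa A * ?vol + ?W * (real (card ?E) - ?d - 1)) - 1 < real N"
      using that(2) by simp
  qed (use that kE vol in auto)
  moreover have "1 \<le> b1"
    using mult_mono[OF one, of 1 "?vol + (real (card ?E) - ?d - 1) * ?W"] vol kE one
    by (simp add: b1_def mult.commute)
  ultimately have first: "\<exists>N0. structure_from A N0" "real (N_Str A) \<le> b1"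
    using structure_from_bound[of b1 A] by blast+
  define b2 where "b2 = (?d + 1) * kappa A * (real (card A) - ?d - 1) * ?W"
  have second: "real (N_Str A) \<le> b2" if "card A \<noteq> CARD('n) + 1"
  proof (rule structure_from_bound)
    have "1 \<le> real (card A) - ?d - 1"
      using that cardA by linarith
    then have kA: "1 \<le> ?W * (real (card A) - ?d - 1)"
      using mult_mono[of 1 ?W 1 "real (card A) - ?d - 1"] W by simp
    have b2: "b2 = (?d + 1) * kappa A * (?W * (real (card A) - ?d - 1))"
      by (simp add: b2_def)
    show "1 \<le> b2"
      using mult_mono[OF one kA] one by (simp add: b2)
    fix N :: nat assume N: "1 \<le> N" "b2 - 1 < real N"
    have "(?d + 1) * (?W * (real (card A) - ?d - 1)) \<le> b2"
      unfolding b2 using \<kappa> kA by (intro mult_right_mono) auto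
    then show "structure_holds A N"
      using N by (intro holdsA) auto
  qed
  \<comment> \<open>The threshold in \<open>holdsA\<close> becomes \<open>-1 < N\<close>, so the
    structure holds for every positive \<open>N\<close>.\<close>
  have third: "N_Str A = 1" if "card A = CARD('n) + 1"
    unfolding N_Str_def
  proof (rule Least_equality)
    show "structure_from A 1"
      unfolding structure_from_def using holdsA that by simp
    show "1 \<le> N0" if "structure_from A N0" for N0
      using that by (simp add: structure_from_def)
  qed
  show ?thesis
    using first second third by (simp add: b1_def b2_def)
qed

end
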